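(* Let $\overline{\sigma}\ge\underline{\sigma}>0$, $G(a)=\frac12(\overline{\sigma}^2a^+-\underline{\sigma}^2a^-)$ for $a\in\mathbb{R}$, and let $\mathcal{N}_G$ be the $G$-normal distribution. Let $\Theta$ be a weakly compact set of probability measures on $(\mathbb{R},\mathcal{B}(\mathbb{R}))$, let $\mathcal{N}[\varphi]=\sup_{\mu\in\Theta}\int\varphi\,d\mu$, and assume $\lim_{N\to\infty}\mathcal{N}[|x|1_{[|x|>N]}]=0$. Let $\phi\in C_{b,Lip}(\mathbb{R})$, let $v$ be the solution to the $G$-heat equation with initial value $\phi$, and for $s\in(0,1)$ set $\phi_s(x):=v(\sqrt{1-s}\,x,s)$, $\mathcal{L}_G\phi_s(x):=G(\phi_s''(x))-\frac{x}{2}\phi_s'(x)$, and $\Theta_s:=\{\mu\in\Theta:\int\phi_s\,d\mu=\mathcal{N}[\phi_s]\}$. Then $$\mathcal{N}_G[\phi]-\mathcal{N}[\phi]=\int_0^1\frac{1}{1-s}\sup_{\mu_s\in\Theta_s}\Big(\int\mathcal{L}_G\phi_s\,d\mu_s\Big)ds=\int_0^1\frac{1}{1-s}\inf_{\mu_s\in\Theta_s}\Big(\int\mathcal{L}_G\phi_s\,d\mu_s\Big)ds.$$ In particular, for a.e. $s\in(0,1)$, $$\sup_{\mu_s\in\Theta_s}\int\mathcal{L}_G\phi_s\,d\mu_s=\inf_{\mu_s\in\Theta_s}\int\mathcal{L}_G\phi_s\,d\mu_s.$$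
   Context: $C_{b,Lip}(\mathbb{R})$ is the set of bounded Lipschitz functions on $\mathbb{R}$; $a^+=\max(a,0)$, $a^-=\max(-a,0)$. For a (possibly unbounded) measurable $\psi$, $\mathcal{N}[\psi]$ means $\sup_{\mu\in\Theta}\int\psi\,d\mu$. $G$-heat equation with initial value $\phi$: $\partial_tv(x,t)-G(D_x^2v(x,t))=0$ for $(x,t)\in\mathbb{R}\times(0,\infty)$, $v(x,0)=\phi(x)$. For $\phi\in C_{b,Lip}(\mathbb{R})$ and $\underline\sigma>0$ it has a unique bounded classical solution $v$ (continuous on $\mathbb{R}\times[0,\infty)$ and $C^{2,1}$ on $\mathbb{R}\times(0,\infty)$), which coincides with the viscosity solution. The $G$-normal distribution $\mathcal{N}_G$ is the sublinear expectation on $C_{b,Lip}(\mathbb{R})$ given by $\mathcal{N}_G[\phi]:=v(0,1)$; more generally $v(x,t)=\mathcal{N}_G[\phi(x+\sqrt t\,\cdot)]$. *)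

theory Defs
  imports "HOL-Probability.Probability"
begin

definition Cb_Lip :: "(real \<Rightarrow> real) set" where
  "Cb_Lip = {\<phi>. bounded (range \<phi>) \<and> (\<exists>L. L-lipschitz_on UNIV \<phi>)}"

definition G_fun :: "real \<Rightarrow> real \<Rightarrow> real \<Rightarrow> real" where
  "G_fun \<sigma>low \<sigma>up a = (\<sigma>up\<^sup>2 * max a 0 - \<sigma>low\<^sup>2 * max (- a) 0) / 2"

text \<open>
  Functions on the half plane are curried as \<open>v x t\<close>; values at \<open>t < 0\<close> are irrelevant.
  The differentiability clauses ensure that each \<open>deriv\<close> below is a genuine derivative.
\<close>

definition C21 :: "(real \<Rightarrow> real \<Rightarrow> real) \<Rightarrow> bool" where
  "C21 v \<longleftrightarrow>
     (\<forall>x. \<forall>t>0. (\<lambda>y. v y t) differentiable (at x)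
              \<and> deriv (\<lambda>y. v y t) differentiable (at x)
              \<and> (\<lambda>\<tau>. v x \<tau>) differentiable (at t)) \<and>
     continuous_on (UNIV \<times> {0<..}) (\<lambda>(x, t). deriv (\<lambda>y. v y t) x) \<and>
     continuous_on (UNIV \<times> {0<..}) (\<lambda>(x, t). deriv (deriv (\<lambda>y. v y t)) x) \<and>
     continuous_on (UNIV \<times> {0<..}) (\<lambda>(x, t). deriv (\<lambda>\<tau>. v x \<tau>) t)"

definition G_heat_solution ::
    "real \<Rightarrow> real \<Rightarrow> (real \<Rightarrow> real) \<Rightarrow> (real \<Rightarrow> real \<Rightarrow> real) \<Rightarrow> bool" where
  "G_heat_solution \<sigma>low \<sigma>up \<phi> v \<longleftrightarrow>
     (\<exists>B. \<forall>x. \<forall>t\<ge>0. \<bar>v x t\<bar> \<le> B) \<and>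
     continuous_on (UNIV \<times> {0..}) (\<lambda>(x, t). v x t) \<and>
     C21 v \<and>
     (\<forall>x. \<forall>t>0. deriv (\<lambda>\<tau>. v x \<tau>) t - G_fun \<sigma>low \<sigma>up (deriv (deriv (\<lambda>y. v y t)) x) = 0) \<and>
     (\<forall>x. v x 0 = \<phi> x)"

text \<open>
  The bounded classical solution is unique on \<open>t \<ge> 0\<close> only (nothing is said about \<open>t < 0\<close>),
  so the description picks out the value at \<open>(0, 1)\<close> rather than the solution itself.
\<close>

definition G_normal :: "real \<Rightarrow> real \<Rightarrow> (real \<Rightarrow> real) \<Rightarrow> real" where
  "G_normal \<sigma>low \<sigma>up \<phi> = (THE c. \<exists>v. G_heat_solution \<sigma>low \<sigma>up \<phi> v \<and> c = v 0 1)"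

definition borel_probs :: "real measure set" where
  "borel_probs = {\<mu>. prob_space \<mu> \<and> sets \<mu> = sets borel}"

text \<open>
  The topology of weak convergence: the coarsest one making \<open>\<mu> \<mapsto> \<integral>f d\<mu>\<close> continuous
  for every bounded continuous \<open>f\<close>.  Its carrier is \<open>borel_probs\<close> (take \<open>U = UNIV\<close>).
\<close>

definition weak_topology :: "real measure topology" where
  "weak_topology = topology_generated_by
     {{\<mu> \<in> borel_probs. (LINT x|\<mu>. f x) \<in> U} | (f :: real \<Rightarrow> real) (U :: real set).
        continuous_on UNIV f \<and> bounded (range f) \<and> open U}"

text \<open>
  The upper expectation \<open>sup\<^sub>\<mu> \<integral>\<psi> d\<mu>\<close> is split in two: a real version, meaningful for bounded
  measurable integrands, and an extended one for nonnegative integrands which may be unbounded,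
  where the Bochner integral and the real supremum could silently take arbitrary values.
\<close>

definition upper_exp :: "real measure set \<Rightarrow> (real \<Rightarrow> real) \<Rightarrow> real" where
  "upper_exp \<Theta> \<psi> = (SUP \<mu>\<in>\<Theta>. LINT x|\<mu>. \<psi> x)"

definition nn_upper_exp :: "real measure set \<Rightarrow> (real \<Rightarrow> ennreal) \<Rightarrow> ennreal" where
  "nn_upper_exp \<Theta> \<psi> = (SUP \<mu>\<in>\<Theta>. \<integral>\<^sup>+ x. \<psi> x \<partial>\<mu>)"

definition maximizers :: "real measure set \<Rightarrow> (real \<Rightarrow> real) \<Rightarrow> real measure set" where
  "maximizers \<Theta> \<psi> = {\<mu> \<in> \<Theta>. (LINT x|\<mu>. \<psi> x) = upper_exp \<Theta> \<psi>}"

definition interp :: "(real \<Rightarrow> real \<Rightarrow> real) \<Rightarrow> real \<Rightarrow> real \<Rightarrow> real" where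
  "interp v s x = v (sqrt (1 - s) * x) s"

definition L_G :: "real \<Rightarrow> real \<Rightarrow> (real \<Rightarrow> real) \<Rightarrow> real \<Rightarrow> real" where
  "L_G \<sigma>low \<sigma>up f x = G_fun \<sigma>low \<sigma>up (deriv (deriv f) x) - x / 2 * deriv f x"

end

theory Submission
  imports Defs
begin

text \<open>
  Along \<open>\<phi>\<^sub>s(x) = v(\<surd>(1 - s) x, s)\<close> one has \<open>\<partial>\<^sub>s \<phi>\<^sub>s = L\<^sub>G \<phi>\<^sub>s / (1 - s)\<close>, and \<open>F(s) = N[\<phi>\<^sub>s]\<close> runs from \<open>N[\<phi>]\<close>
  at \<open>s = 0\<close> to \<open>v(0, 1)\<close> at \<open>s = 1\<close>.  By Danskin's envelope theorem on the weakly compact set \<open>\<Theta>\<close>,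
  the right and left derivatives of \<open>F\<close> are the supremum and the infimum of \<open>\<integral>\<partial>\<^sub>s \<phi>\<^sub>s d\<mu>\<close> over the
  maximizers, so each of them integrates to \<open>F(1) - F(0)\<close>; being ordered, they agree almost
  everywhere.

  No interior regularity theory is needed for the bounds on \<open>\<partial>\<^sub>s \<phi>\<^sub>s\<close>.  Comparing \<open>v\<close> with its
  translates gives \<open>\<bar>v(x, t) - v(y, t)\<bar> \<le> L \<bar>x - y\<bar>\<close>, and comparing it with its parabolic rescalings
  gives \<open>\<bar>v(x, t) - v(x, t')\<bar> \<le> L \<sigma>up \<bar>\<surd>t - \<surd>t'\<bar>\<close>.  Thus the difference quotients of \<open>\<phi>\<^sub>s\<close> in \<open>s\<close>
  grow at most linearly in \<open>x\<close>, which the uniform integrability of \<open>\<Theta>\<close> controls, and the increments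
  of \<open>F\<close> are dominated by those of an increasing function that is smooth on \<open>(0, 1)\<close>.
\<close>

section \<open>Comparison for the G-heat equation\<close>

text \<open>If \<open>D\<close> were positive, \<open>f'\<close>, which vanishes at the maximum,
  would be positive just to the right of \<open>x\<close>, and \<open>f\<close> would increase
  there.\<close>

lemma second_derivative_nonpos_at_max:
  fixes f f' :: "real \<Rightarrow> real"
  assumes f: "\<And>y. (f has_real_derivative f' y) (at y)"
    and f': "(f' has_real_derivative D) (at x)"
    and d: "0 < d" and max: "\<And>y. \<bar>x - y\<bar> < d \<Longrightarrow> f y \<le> f x"
  shows "D \<le> 0"
proof (rule ccontr)
  assume "\<not> D \<le> 0"
  then obtain e where e: "e > 0" "\<And>h. h > 0 \<Longrightarrow> h < e \<Longrightarrow> f' x < f' (x + h)"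
    using DERIV_pos_inc_right[OF f'] by auto
  have f'x: "f' x = 0"
    using DERIV_local_max[OF f d] max by blast
  define h where "h = min d e / 2"
  have h: "0 < h" "h < d" "h < e" using d e(1) by (auto simp: h_def)
  have "f x < f (x + h)"
  proof (rule DERIV_pos_imp_increasing_open[of x "x + h" f])
    fix y assume "x < y" "y < x + h"
    then have "f' y > 0" using e(2)[of "y - x"] h f'x by auto
    then show "\<exists>z. (f has_real_derivative z) (at y) \<and> z > 0" using f by blast
  next
    show "continuous_on {x..x + h} f"
      by (meson DERIV_isCont continuous_at_imp_continuous_on f)
  qed (use h in auto)
  moreover have "f (x + h) \<le> f x" using max[of "x + h"] h by auto
  ultimately show False by simp
qed

text \<open>The barrier has second space derivative \<open>2 * \<beta>\<close>, so it solves
  \<open>wt = K * max wxx 0\<close> exactly. A slightly steeper barrier dominates \<open>w\<close>,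
  which is bounded above, far out in space; a violation would therefore produce a positive maximum
  on a compact rectangle, where the differential inequality fails.\<close>

lemma parabolic_maximum_principle:
  fixes w wx wxx wt :: "real \<Rightarrow> real \<Rightarrow> real"
  assumes K: "0 \<le> K" and \<beta>: "0 \<le> \<beta>"
    and cont: "continuous_on (UNIV \<times> {0..}) (\<lambda>(x, t). w x t)"
    and bdd: "\<And>x t. 0 \<le> t \<Longrightarrow> w x t \<le> B"
    and wx: "\<And>x t. 0 < t \<Longrightarrow> ((\<lambda>y. w y t) has_real_derivative wx x t) (at x)"
    and wxx: "\<And>x t. 0 < t \<Longrightarrow> ((\<lambda>y. wx y t) has_real_derivative wxx x t) (at x)"
    and wt: "\<And>x t. 0 < t \<Longrightarrow> ((\<lambda>\<tau>. w x \<tau>) has_real_derivative wt x t) (at t)"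
    and sub: "\<And>x t. 0 < t \<Longrightarrow> wt x t \<le> K * max (wxx x t) 0"
    and init: "\<And>x. w x 0 \<le> \<alpha> + \<beta> * x\<^sup>2"
    and t: "0 \<le> t"
  shows "w x t \<le> \<alpha> + \<beta> * x\<^sup>2 + 2 * K * \<beta> * t"
proof -
  \<comment> \<open>The two perturbations have different tasks: the extra curvature forces
    compactness, the extra slope \<open>\<epsilon>\<close> in time makes the barrier a strict
    supersolution.\<close>
  have strict: "w x t \<le> \<alpha> + (\<beta> + \<epsilon>) * x\<^sup>2 + (2 * K * (\<beta> + \<epsilon>) + \<epsilon>) * t" if \<epsilon>: "0 < \<epsilon>" for \<epsilon>
  proof (rule ccontr)
    define c where "c = 2 * K * (\<beta> + \<epsilon>) + \<epsilon>"
    define \<Phi> where "\<Phi> y s = w y s - (\<alpha> + (\<beta> + \<epsilon>) * y\<^sup>2 + c * s)" for y s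
    assume "\<not> ?thesis"
    then have pos: "\<Phi> x t > 0" by (simp add: \<Phi>_def c_def)
    have c: "c \<ge> 0" using K \<beta> \<epsilon> by (simp add: c_def)
    \<comment> \<open>Beyond \<open>R\<close> the term \<open>\<epsilon> * y\<^sup>2\<close> absorbs
      both \<open>B\<close> and \<open>\<alpha>\<close>. The summand 1 yields
      \<open>R \<le> R * R\<close>, and \<open>\<bar>x\<bar>\<close> places the point of violation
      inside the rectangle.\<close>
    define R where "R = \<bar>x\<bar> + (\<bar>B\<bar> + \<bar>\<alpha>\<bar>) / \<epsilon> + 1"
    have "0 \<le> (\<bar>B\<bar> + \<bar>\<alpha>\<bar>) / \<epsilon>" using \<epsilon> by simp
    then have R: "\<bar>x\<bar> < R" "1 \<le> R" by (auto simp: R_def)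
    have far: "\<Phi> y s \<le> 0" if "\<bar>y\<bar> \<ge> R" "0 \<le> s" for y s
    proof -
      have "(\<bar>B\<bar> + \<bar>\<alpha>\<bar>) / \<epsilon> \<le> R" using R by (simp add: R_def)
      also have "R \<le> R * R" using R by simp
      also have "R * R \<le> \<bar>y\<bar> * \<bar>y\<bar>" using that R by (intro mult_mono) auto
      finally have "\<bar>B\<bar> + \<bar>\<alpha>\<bar> \<le> \<epsilon> * y\<^sup>2" using \<epsilon> by (simp add: field_simps power2_eq_square)
      moreover have "0 \<le> \<beta> * y\<^sup>2" "0 \<le> c * s" using \<beta> c that by auto
      ultimately show ?thesis using bdd[OF that(2), of y] by (simp add: \<Phi>_def algebra_simps)
    qed
    define S where "S = {-R..R} \<times> {0..t}"
    have "compact S" unfolding S_def by (intro compact_Times compact_Icc)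
    moreover have "S \<noteq> {}" using R t by (auto simp: S_def)
    moreover have "continuous_on S (\<lambda>(y, s). \<Phi> y s)"
    proof -
      have "continuous_on S (\<lambda>(y, s). w y s)"
        by (rule continuous_on_subset[OF cont]) (auto simp: S_def)
      then show ?thesis unfolding \<Phi>_def case_prod_unfold by (intro continuous_intros)
    qed
    ultimately obtain p where p: "p \<in> S" "\<forall>q\<in>S. (\<lambda>(y, s). \<Phi> y s) q \<le> (\<lambda>(y, s). \<Phi> y s) p"
      using continuous_attains_sup by blast
    obtain y s where ys: "p = (y, s)" by force
    have max: "\<Phi> z r \<le> \<Phi> y s" if "z \<in> {-R..R}" "r \<in> {0..t}" for z r
      using p(2) that unfolding ys S_def by auto
    have ys_in: "y \<in> {-R..R}" "s \<in> {0..t}" using p(1) ys by (auto simp: S_def)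
    have posys: "\<Phi> y s > 0" using max[of x t] pos R(1) t by (simp add: abs_less_iff)
    have yR: "\<bar>y\<bar> < R" using far[of y s] posys ys_in by force
    have "s \<noteq> 0"
    proof
      assume "s = 0"
      then have "\<Phi> y s \<le> - \<epsilon> * y\<^sup>2" using init[of y] by (simp add: \<Phi>_def algebra_simps)
      moreover have "0 \<le> \<epsilon> * y\<^sup>2" using \<epsilon> by simp
      ultimately show False using posys by simp
    qed
    then have s: "0 < s" "s \<le> t" using ys_in by auto
    have dx: "((\<lambda>y. \<Phi> y s) has_real_derivative (wx z s - (\<beta> + \<epsilon>) * (2 * z))) (at z)" for z
      unfolding \<Phi>_def by (rule derivative_eq_intros wx refl s(1) | simp)+
    have dxx: "((\<lambda>z. wx z s - (\<beta> + \<epsilon>) * (2 * z)) has_real_derivative (wxx y s - (\<beta> + \<epsilon>) * 2)) (at y)"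
      by (rule derivative_eq_intros wxx refl s(1) | simp)+
    \<comment> \<open>The maximum is interior in space because \<open>\<Phi>\<close> is nonpositive
      for \<open>\<bar>y\<bar> \<ge> R\<close>, so the second-order condition applies.\<close>
    have "wxx y s - (\<beta> + \<epsilon>) * 2 \<le> 0"
    proof (rule second_derivative_nonpos_at_max[OF dx dxx, of "R - \<bar>y\<bar>"])
      show "\<Phi> z s \<le> \<Phi> y s" if "\<bar>y - z\<bar> < R - \<bar>y\<bar>" for z
      proof (rule max)
        show "z \<in> {-R..R}" using that by (auto simp: abs_if split: if_splits)
      qed (use ys_in in auto)
    qed (use yR in auto)
    then have "K * max (wxx y s) 0 \<le> K * (2 * (\<beta> + \<epsilon>))" using K \<beta> \<epsilon> by (intro mult_left_mono) auto
    with sub[OF s(1), of y] have wt_le: "wt y s \<le> c - \<epsilon>" by (simp add: c_def mult_ac)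
    have dt: "((\<lambda>s. \<Phi> y s) has_real_derivative (wt y s - c)) (at s)"
      unfolding \<Phi>_def by (rule derivative_eq_intros wt refl s(1) | simp)+
    \<comment> \<open>The maximum may sit at the final time \<open>s = t\<close>, so only earlier
      times are compared: a negative time derivative makes \<open>\<Phi>\<close> larger just before
      \<open>s\<close>.\<close>
    obtain d where d: "d > 0" "\<And>h. h > 0 \<Longrightarrow> h < d \<Longrightarrow> \<Phi> y s < \<Phi> y (s - h)"
      using DERIV_neg_dec_left[OF dt] wt_le \<epsilon> by auto
    define h where "h = min d s / 2"
    have h: "0 < h" "h < d" "h < s" using d(1) s by (auto simp: h_def)
    have "\<Phi> y (s - h) \<le> \<Phi> y s" using max[of y "s - h"] ys_in h by auto
    with d(2)[of h] h show False by auto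
  qed
  have "((\<lambda>\<epsilon>. \<alpha> + (\<beta> + \<epsilon>) * x\<^sup>2 + (2 * K * (\<beta> + \<epsilon>) + \<epsilon>) * t) \<longlongrightarrow>
      \<alpha> + (\<beta> + 0) * x\<^sup>2 + (2 * K * (\<beta> + 0) + 0) * t) (at_right 0)"
    by (intro tendsto_intros)
  then have "w x t \<le> \<alpha> + (\<beta> + 0) * x\<^sup>2 + (2 * K * (\<beta> + 0) + 0) * t"
    by (rule tendsto_lowerbound)
      (auto intro!: eventually_at_right_less[THEN eventually_mono] strict)
  then show ?thesis by simp
qed

text \<open>\<open>G\<close> is the supremum of the linear maps \<open>c * a / 2\<close> over
  \<open>c\<close> between \<open>\<sigma>low\<^sup>2\<close> and \<open>\<sigma>up\<^sup>2\<close>,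
  hence subadditive, and \<open>G (a - b)\<close> is at most the largest slope times the positive
  part. This one-sided bound makes the difference of two solutions a subsolution.\<close>

lemma G_fun_diff_le:
  assumes "0 \<le> \<sigma>low" "\<sigma>low \<le> \<sigma>up"
  shows "G_fun \<sigma>low \<sigma>up a - G_fun \<sigma>low \<sigma>up b \<le> \<sigma>up\<^sup>2 / 2 * max (a - b) 0"
proof -
  have sq: "\<sigma>low\<^sup>2 \<le> \<sigma>up\<^sup>2" "0 \<le> \<sigma>low\<^sup>2" using assms by (auto intro: power_mono)
  define A where "A = \<sigma>low\<^sup>2"
  define C where "C = \<sigma>up\<^sup>2"
  have AC: "A \<le> C" "0 \<le> A" using sq by (auto simp: A_def C_def)
  have up: "x * A \<le> x * C" if "0 \<le> x" for x using AC that by (intro mult_left_mono)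
  have "C * max a 0 - A * max (- a) 0 - (C * max b 0 - A * max (- b) 0) \<le> C * max (a - b) 0"
  proof (cases "b \<le> a")
    case True
    then show ?thesis using up[of "a - b"] up[of "- b"] AC
      by (auto simp: max_def algebra_simps)
  next
    case False
    moreover have "A * a \<le> A * b" "C * a \<le> C * b" using False AC by (auto intro: mult_left_mono)
    moreover have "A * a \<le> 0 \<or> 0 \<le> a" "C * b \<ge> 0 \<or> b \<le> 0" using AC by (auto intro: mult_nonneg_nonpos)
    ultimately show ?thesis by (auto simp: max_def algebra_simps)
  qed
  then show ?thesis by (simp add: G_fun_def A_def C_def field_simps)
qed

lemma G_fun_mult: "0 \<le> c \<Longrightarrow> G_fun \<sigma>low \<sigma>up (c * a) = c * G_fun \<sigma>low \<sigma>up a"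
  by (auto simp: G_fun_def max_def algebra_simps zero_le_mult_iff mult_le_0_iff diff_divide_distrib)

lemma G_heat_solution_derivs:
  assumes "G_heat_solution \<sigma>low \<sigma>up \<phi> v" "0 < t"
  shows "((\<lambda>y. v y t) has_real_derivative deriv (\<lambda>y. v y t) x) (at x)"
    and "(deriv (\<lambda>y. v y t) has_real_derivative deriv (deriv (\<lambda>y. v y t)) x) (at x)"
    and "((\<lambda>\<tau>. v x \<tau>) has_real_derivative deriv (\<lambda>\<tau>. v x \<tau>) t) (at t)"
    and "deriv (\<lambda>\<tau>. v x \<tau>) t = G_fun \<sigma>low \<sigma>up (deriv (deriv (\<lambda>y. v y t)) x)"
proof -
  have "C21 v" and eq: "deriv (\<lambda>\<tau>. v x \<tau>) t - G_fun \<sigma>low \<sigma>up (deriv (deriv (\<lambda>y. v y t)) x) = 0"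
    using assms by (auto simp: G_heat_solution_def)
  then have "(\<lambda>y. v y t) differentiable (at x)" "deriv (\<lambda>y. v y t) differentiable (at x)"
    "(\<lambda>\<tau>. v x \<tau>) differentiable (at t)"
    using assms(2) unfolding C21_def by blast+
  then show "((\<lambda>y. v y t) has_real_derivative deriv (\<lambda>y. v y t) x) (at x)"
    "(deriv (\<lambda>y. v y t) has_real_derivative deriv (deriv (\<lambda>y. v y t)) x) (at x)"
    "((\<lambda>\<tau>. v x \<tau>) has_real_derivative deriv (\<lambda>\<tau>. v x \<tau>) t) (at t)"
    unfolding DERIV_deriv_iff_real_differentiable .
  show "deriv (\<lambda>\<tau>. v x \<tau>) t = G_fun \<sigma>low \<sigma>up (deriv (deriv (\<lambda>y. v y t)) x)"
    using eq by simp
qed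

text \<open>The difference of two solutions obeys the maximum principle with
  \<open>K = \<sigma>up\<^sup>2 / 2\<close>. The case \<open>\<beta> = 0\<close> serves uniqueness
  and translations; a quadratic gap is what parabolic rescaling produces.\<close>

lemma G_heat_comparison:
  assumes \<sigma>: "0 \<le> \<sigma>low" "\<sigma>low \<le> \<sigma>up"
    and u1: "G_heat_solution \<sigma>low \<sigma>up \<phi>1 u1" and u2: "G_heat_solution \<sigma>low \<sigma>up \<phi>2 u2"
    and init: "\<And>x. \<phi>1 x - \<phi>2 x \<le> \<alpha> + \<beta> * x\<^sup>2" and \<beta>: "0 \<le> \<beta>" and t: "0 \<le> t"
  shows "u1 x t - u2 x t \<le> \<alpha> + \<beta> * x\<^sup>2 + \<sigma>up\<^sup>2 * \<beta> * t"
proof -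
  obtain B1 B2 where B: "\<And>x t. 0 \<le> t \<Longrightarrow> \<bar>u1 x t\<bar> \<le> B1" "\<And>x t. 0 \<le> t \<Longrightarrow> \<bar>u2 x t\<bar> \<le> B2"
    using u1 u2 by (auto simp: G_heat_solution_def)
  have "u1 x t - u2 x t \<le> \<alpha> + \<beta> * x\<^sup>2 + 2 * (\<sigma>up\<^sup>2 / 2) * \<beta> * t"
  proof (rule parabolic_maximum_principle[where w = "\<lambda>x t. u1 x t - u2 x t" and B = "B1 + B2"
      and wx = "\<lambda>x t. deriv (\<lambda>y. u1 y t) x - deriv (\<lambda>y. u2 y t) x"
      and wxx = "\<lambda>x t. deriv (deriv (\<lambda>y. u1 y t)) x - deriv (deriv (\<lambda>y. u2 y t)) x"
      and wt = "\<lambda>x t. deriv (\<lambda>\<tau>. u1 x \<tau>) t - deriv (\<lambda>\<tau>. u2 x \<tau>) t"])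
    show "continuous_on (UNIV \<times> {0..}) (\<lambda>(x, t). u1 x t - u2 x t)"
      using u1 u2 unfolding G_heat_solution_def case_prod_unfold by (auto intro: continuous_intros)
    show "u1 x t - u2 x t \<le> B1 + B2" if "0 \<le> t" for x t
      using B(1)[OF that, of x] B(2)[OF that, of x] by linarith
    show "u1 x 0 - u2 x 0 \<le> \<alpha> + \<beta> * x\<^sup>2" for x
      using init u1 u2 by (simp add: G_heat_solution_def)
  next
    fix x t :: real assume t: "0 < t"
    note d1 = G_heat_solution_derivs[OF u1 t] and d2 = G_heat_solution_derivs[OF u2 t]
    show "((\<lambda>y. u1 y t - u2 y t) has_real_derivative
        deriv (\<lambda>y. u1 y t) x - deriv (\<lambda>y. u2 y t) x) (at x)"
      by (intro DERIV_diff d1 d2)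
    show "((\<lambda>y. deriv (\<lambda>y. u1 y t) y - deriv (\<lambda>y. u2 y t) y) has_real_derivative
        deriv (deriv (\<lambda>y. u1 y t)) x - deriv (deriv (\<lambda>y. u2 y t)) x) (at x)"
      by (intro DERIV_diff d1 d2)
    show "((\<lambda>\<tau>. u1 x \<tau> - u2 x \<tau>) has_real_derivative
        deriv (\<lambda>\<tau>. u1 x \<tau>) t - deriv (\<lambda>\<tau>. u2 x \<tau>) t) (at t)"
      by (intro DERIV_diff d1 d2)
    show "deriv (\<lambda>\<tau>. u1 x \<tau>) t - deriv (\<lambda>\<tau>. u2 x \<tau>) t
        \<le> \<sigma>up\<^sup>2 / 2 * max (deriv (deriv (\<lambda>y. u1 y t)) x - deriv (deriv (\<lambda>y. u2 y t)) x) 0"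
      unfolding d1(4) d2(4) by (rule G_fun_diff_le[OF \<sigma>])
  qed (use \<beta> t in auto)
  then show ?thesis by simp
qed

text \<open>The chain rule multiplies the time derivative and the second space derivative alike by
  \<open>l\<^sup>2\<close>, and \<open>G\<close> is positively homogeneous. Taking
  \<open>l = 1\<close> gives the translates.\<close>

lemma G_heat_solution_scale:
  assumes v: "G_heat_solution \<sigma>low \<sigma>up \<phi> v" and l: "0 < l"
  shows "G_heat_solution \<sigma>low \<sigma>up (\<lambda>y. \<phi> (p + l * y)) (\<lambda>y t. v (p + l * y) (l\<^sup>2 * t))"
proof -
  let ?u = "\<lambda>y t. v (p + l * y) (l\<^sup>2 * t)"
  have l2: "0 < l\<^sup>2 * t" if "0 < t" for t using l that by simp
  have dx: "((\<lambda>y. ?u y t) has_real_derivative l * deriv (\<lambda>y. v y (l\<^sup>2 * t)) (p + l * x)) (at x)"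
    if "0 < t" for x t
  proof -
    have "((\<lambda>y. p + l * y) has_real_derivative l) (at x)" by (auto intro!: derivative_eq_intros)
    from DERIV_chain2[OF G_heat_solution_derivs(1)[OF v l2[OF that]] this]
    show ?thesis by (simp add: mult.commute)
  qed
  then have dx': "deriv (\<lambda>y. ?u y t) = (\<lambda>x. l * deriv (\<lambda>y. v y (l\<^sup>2 * t)) (p + l * x))"
    if "0 < t" for t using that by (auto intro!: DERIV_imp_deriv)
  have dxx: "((\<lambda>x. l * deriv (\<lambda>y. v y (l\<^sup>2 * t)) (p + l * x)) has_real_derivative
      l\<^sup>2 * deriv (deriv (\<lambda>y. v y (l\<^sup>2 * t))) (p + l * x)) (at x)" if "0 < t" for x t
  proof -
    have "((\<lambda>y. p + l * y) has_real_derivative l) (at x)" by (auto intro!: derivative_eq_intros)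
    from DERIV_cmult[OF DERIV_chain2[OF G_heat_solution_derivs(2)[OF v l2[OF that]] this], of l]
    show ?thesis by (simp add: power2_eq_square mult_ac)
  qed
  have dxx': "deriv (deriv (\<lambda>y. ?u y t)) x = l\<^sup>2 * deriv (deriv (\<lambda>y. v y (l\<^sup>2 * t))) (p + l * x)"
    if "0 < t" for x t unfolding dx'[OF that] by (rule DERIV_imp_deriv[OF dxx[OF that]])
  have dt: "((\<lambda>\<tau>. ?u x \<tau>) has_real_derivative l\<^sup>2 * deriv (\<lambda>\<tau>. v (p + l * x) \<tau>) (l\<^sup>2 * t)) (at t)"
    if "0 < t" for x t
  proof -
    have "((\<lambda>t. l\<^sup>2 * t) has_real_derivative l\<^sup>2) (at t)" by (auto intro!: derivative_eq_intros)
    from DERIV_chain2[OF G_heat_solution_derivs(3)[OF v l2[OF that]] this]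
    show ?thesis by (simp add: mult.commute)
  qed
  note dt' = DERIV_imp_deriv[OF dt]
  \<comment> \<open>\<open>S\<close> is the closed half line for \<open>v\<close> itself and the
    open one for its derivatives.\<close>
  have cont: "continuous_on (UNIV \<times> S) (\<lambda>(x, t). f (p + l * x) (l\<^sup>2 * t))"
    if f: "continuous_on (UNIV \<times> S) (\<lambda>(x, t). f x t)" and S: "\<And>t. t \<in> S \<Longrightarrow> l\<^sup>2 * t \<in> S"
    for f :: "real \<Rightarrow> real \<Rightarrow> real" and S
  proof -
    have "continuous_on (UNIV \<times> S) (\<lambda>q. (\<lambda>(x, t). f x t) ((\<lambda>(x, t). (p + l * x, l\<^sup>2 * t)) q))"
      by (rule continuous_on_compose2[OF f])
        (auto simp: case_prod_unfold S intro!: continuous_intros)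
    then show ?thesis by (simp add: case_prod_unfold)
  qed
  have vc: "continuous_on (UNIV \<times> {0..}) (\<lambda>(x, t). v x t)"
      "continuous_on (UNIV \<times> {0<..}) (\<lambda>(x, t). deriv (\<lambda>y. v y t) x)"
      "continuous_on (UNIV \<times> {0<..}) (\<lambda>(x, t). deriv (deriv (\<lambda>y. v y t)) x)"
      "continuous_on (UNIV \<times> {0<..}) (\<lambda>(x, t). deriv (\<lambda>\<tau>. v x \<tau>) t)"
    using v by (auto simp: G_heat_solution_def C21_def)
  have "C21 ?u"
    unfolding C21_def
  proof (intro conjI allI impI)
    fix x t :: real assume t: "0 < t"
    show "(\<lambda>y. ?u y t) differentiable (at x)" using dx[OF t] by (auto simp: real_differentiable_def)
    show "deriv (\<lambda>y. ?u y t) differentiable (at x)"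
      unfolding dx'[OF t] using dxx[OF t] by (auto simp: real_differentiable_def)
    show "(\<lambda>\<tau>. ?u x \<tau>) differentiable (at t)" using dt[OF t] by (auto simp: real_differentiable_def)
  next
    show "continuous_on (UNIV \<times> {0<..}) (\<lambda>(x, t). deriv (\<lambda>y. ?u y t) x)"
      by (rule continuous_on_eq[OF continuous_on_mult_left[OF cont[OF vc(2)], of "l"]])
        (use l in \<open>auto simp: dx'\<close>)
    show "continuous_on (UNIV \<times> {0<..}) (\<lambda>(x, t). deriv (deriv (\<lambda>y. ?u y t)) x)"
      by (rule continuous_on_eq[OF continuous_on_mult_left[OF cont[OF vc(3)], of "l\<^sup>2"]])
        (use l in \<open>auto simp: dxx'\<close>)
    show "continuous_on (UNIV \<times> {0<..}) (\<lambda>(x, t). deriv (\<lambda>\<tau>. ?u x \<tau>) t)"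
      by (rule continuous_on_eq[OF continuous_on_mult_left[OF cont[OF vc(4)], of "l\<^sup>2"]])
        (use l in \<open>auto simp: dt'\<close>)
  qed
  moreover have "deriv (\<lambda>\<tau>. ?u x \<tau>) t - G_fun \<sigma>low \<sigma>up (deriv (deriv (\<lambda>y. ?u y t)) x) = 0"
    if "0 < t" for x t
    unfolding dt'[OF that] dxx'[OF that] G_fun_mult[OF zero_le_power2]
      G_heat_solution_derivs(4)[OF v l2[OF that]] by simp
  moreover have "continuous_on (UNIV \<times> {0..}) (\<lambda>(x, t). ?u x t)"
    by (rule cont[OF vc(1)]) auto
  moreover have "\<exists>B. \<forall>x. \<forall>t\<ge>0. \<bar>?u x t\<bar> \<le> B"
  proof -
    obtain B where "\<And>x t. 0 \<le> t \<Longrightarrow> \<bar>v x t\<bar> \<le> B" using v by (auto simp: G_heat_solution_def)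
    then show ?thesis by (intro exI[of _ B]) auto
  qed
  moreover have "v x 0 = \<phi> x" for x using v by (simp add: G_heat_solution_def)
  ultimately show ?thesis by (simp add: G_heat_solution_def)
qed

text \<open>Comparison in both directions with \<open>\<alpha> = \<beta> = 0\<close> makes the value
  at \<open>(0, 1)\<close> independent of the solution, so the definite description denotes
  it.\<close>

lemma G_normal_eq:
  assumes \<sigma>: "0 \<le> \<sigma>low" "\<sigma>low \<le> \<sigma>up" and v: "G_heat_solution \<sigma>low \<sigma>up \<phi> v"
  shows "G_normal \<sigma>low \<sigma>up \<phi> = v 0 1"
  unfolding G_normal_def
proof (rule the_equality)
  fix c assume "\<exists>u. G_heat_solution \<sigma>low \<sigma>up \<phi> u \<and> c = u 0 1"
  then obtain u where u: "G_heat_solution \<sigma>low \<sigma>up \<phi> u" "c = u 0 1" by blast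
  show "c = v 0 1"
    using G_heat_comparison[OF \<sigma> u(1) v, where \<alpha> = 0 and \<beta> = 0 and t = 1 and x = 0]
      G_heat_comparison[OF \<sigma> v u(1), where \<alpha> = 0 and \<beta> = 0 and t = 1 and x = 0] u(2) by simp
qed (use v in blast)

section \<open>Regularity of solutions in space and time\<close>

lemma G_heat_solution_lipschitz:
  assumes \<sigma>: "0 \<le> \<sigma>low" "\<sigma>low \<le> \<sigma>up" and v: "G_heat_solution \<sigma>low \<sigma>up \<phi> v"
    and L: "L-lipschitz_on UNIV \<phi>" and t: "0 \<le> t"
  shows "\<bar>v x t - v y t\<bar> \<le> L * \<bar>x - y\<bar>"
proof -
  have "v x t - v y t \<le> L * \<bar>x - y\<bar>" for x y
  proof -
    \<comment> \<open>The translate by \<open>x - y\<close> takes the value \<open>v x t\<close> at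
      the point \<open>y\<close>. The factor \<open>1 *\<close> matches the rescaling lemma at
      \<open>l = 1\<close>.\<close>
    have "\<phi> (x - y + 1 * z) - \<phi> z \<le> L * \<bar>x - y\<bar> + 0 * z\<^sup>2" for z
      using lipschitz_onD[OF L, of "x - y + 1 * z" z] by (simp add: dist_real_def)
    from G_heat_comparison[OF \<sigma> G_heat_solution_scale[OF v zero_less_one] v this _ t, of y]
    show ?thesis by simp
  qed
  from this[of x y] this[of y x] show ?thesis by (auto simp: abs_minus_commute)
qed

text \<open>
  Parabolic scaling about \<open>(x, 0)\<close> with ratio \<open>l = \<surd>(t' / t)\<close> changes the initial value
  by at most \<open>L \<bar>l - 1\<bar> \<bar>y\<bar>\<close>, which Young's inequality bounds by a quadratic barrier;
  the weight \<open>c = \<sigma>up \<surd>t\<close> is the optimal one.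
\<close>

lemma G_heat_solution_time_regularity_pos:
  assumes \<sigma>: "0 \<le> \<sigma>low" "\<sigma>low \<le> \<sigma>up" "0 < \<sigma>up" and v: "G_heat_solution \<sigma>low \<sigma>up \<phi> v"
    and L: "L-lipschitz_on UNIV \<phi>" and t: "0 < t" "0 < t'"
  shows "v x t' - v x t \<le> L * \<sigma>up * \<bar>sqrt t' - sqrt t\<bar>"
proof -
  define l where "l = sqrt (t' / t)"
  have l: "0 < l" "l\<^sup>2 * t = t'" using t by (auto simp: l_def)
  have L0: "0 \<le> L" using L by (rule lipschitz_on_nonneg)
  define c where "c = \<sigma>up * sqrt t"
  have c: "0 < c" using t \<sigma>(3) by (simp add: c_def)
  define A where "A = L * \<bar>l - 1\<bar> / 2"
  have A: "0 \<le> A" using L0 by (simp add: A_def)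
  have "\<phi> (x + l * y) - \<phi> (x + 1 * y) \<le> A * c + A / c * y\<^sup>2" for y
  proof -
    have "\<phi> (x + l * y) - \<phi> (x + 1 * y) \<le> L * \<bar>(l - 1) * y\<bar>"
      using lipschitz_onD[OF L, of "x + l * y" "x + 1 * y"] by (simp add: dist_real_def algebra_simps)
    also have "\<dots> = A * (2 * \<bar>y\<bar>)" by (simp add: A_def abs_mult)
    also have "2 * \<bar>y\<bar> \<le> c + y\<^sup>2 / c"
    proof -
      have "0 \<le> (c - \<bar>y\<bar>)\<^sup>2" by simp
      also have "\<dots> = c\<^sup>2 + y\<^sup>2 - c * (2 * \<bar>y\<bar>)" by (simp add: power2_diff)
      finally show ?thesis using c by (simp add: field_simps power2_eq_square)
    qed
    then have "A * (2 * \<bar>y\<bar>) \<le> A * (c + y\<^sup>2 / c)" by (rule mult_left_mono[OF _ A])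
    finally show ?thesis by (simp add: algebra_simps)
  qed
  \<comment> \<open>At \<open>y = 0\<close> both rescaled solutions are evaluated at the point
    \<open>x\<close>, at the times \<open>l\<^sup>2 * t = t'\<close> and \<open>t\<close>, and the
    term quadratic in \<open>y\<close> disappears.\<close>
  from G_heat_comparison[OF \<sigma>(1,2) G_heat_solution_scale[OF v l(1)]
      G_heat_solution_scale[OF v zero_less_one] this, of t 0] A c t
  have "v x t' - v x t \<le> A * c + \<sigma>up\<^sup>2 * (A / c) * t" by (simp add: l)
  also have "\<dots> = A * (c + \<sigma>up\<^sup>2 * t / c)" by (simp add: algebra_simps)
  also have "\<sigma>up\<^sup>2 * t / c = c"
    using c t by (simp add: c_def field_simps power2_eq_square)
  also have "A * (c + c) = L * \<sigma>up * (\<bar>l - 1\<bar> * sqrt t)" by (simp add: A_def c_def)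
  also have "\<bar>l - 1\<bar> * sqrt t = \<bar>(l - 1) * sqrt t\<bar>" using t by (simp add: abs_mult)
  also have "(l - 1) * sqrt t = sqrt t' - sqrt t"
    using t by (simp add: l_def left_diff_distrib flip: real_sqrt_mult)
  finally show ?thesis .
qed

text \<open>Rescaling relates positive times only; time 0 is reached by shifting both times by
  \<open>e\<close> and letting \<open>e\<close> tend to 0, since \<open>v\<close> is continuous up
  to the initial time.\<close>

lemma G_heat_solution_time_regularity:
  assumes \<sigma>: "0 \<le> \<sigma>low" "\<sigma>low \<le> \<sigma>up" "0 < \<sigma>up" and v: "G_heat_solution \<sigma>low \<sigma>up \<phi> v"
    and L: "L-lipschitz_on UNIV \<phi>" and t: "0 \<le> t" "0 \<le> t'"
  shows "\<bar>v x t - v x t'\<bar> \<le> L * \<sigma>up * \<bar>sqrt t - sqrt t'\<bar>"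
proof -
  have cont: "continuous_on {0..} (\<lambda>t. v x t)"
  proof -
    have "continuous_on (UNIV \<times> {0..}) (\<lambda>(x, t). v x t)" using v by (simp add: G_heat_solution_def)
    moreover have "continuous_on {0..} (\<lambda>t. (x, t))" by (intro continuous_intros)
    ultimately have "continuous_on {0..} (\<lambda>t. (\<lambda>(x, t). v x t) (x, t))"
      by (rule continuous_on_compose2) auto
    then show ?thesis by simp
  qed
  have shift: "((\<lambda>e. v x (r + e)) \<longlongrightarrow> v x r) (at_right 0)" if "0 \<le> r" for r
  proof -
    have "continuous_on {0..} (\<lambda>e. v x (r + e))"
      by (rule continuous_on_compose2[OF cont]) (use that in \<open>auto intro!: continuous_intros\<close>)
    then have "((\<lambda>e. v x (r + e)) \<longlongrightarrow> v x (r + 0)) (at 0 within {0..})"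
      unfolding continuous_on_def by blast
    then show ?thesis by (auto intro: tendsto_within_subset)
  qed
  have "((\<lambda>e. \<bar>v x (t + e) - v x (t' + e)\<bar>) \<longlongrightarrow> \<bar>v x t - v x t'\<bar>) (at_right 0)"
    by (intro tendsto_intros shift t)
  moreover have "((\<lambda>e. L * \<sigma>up * \<bar>sqrt (t + e) - sqrt (t' + e)\<bar>) \<longlongrightarrow>
      L * \<sigma>up * \<bar>sqrt (t + 0) - sqrt (t' + 0)\<bar>) (at_right 0)"
    by (intro tendsto_intros)
  moreover have "\<bar>v x (t + e) - v x (t' + e)\<bar> \<le> L * \<sigma>up * \<bar>sqrt (t + e) - sqrt (t' + e)\<bar>"
    if "0 < e" for e
    using G_heat_solution_time_regularity_pos[OF \<sigma> v L, of "t + e" "t' + e" x]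
      G_heat_solution_time_regularity_pos[OF \<sigma> v L, of "t' + e" "t + e" x] t that
    by (auto simp: abs_minus_commute)
  then have "\<forall>\<^sub>F e in at_right 0. \<bar>v x (t + e) - v x (t' + e)\<bar> \<le> L * \<sigma>up * \<bar>sqrt (t + e) - sqrt (t' + e)\<bar>"
    using eventually_at_right_less by (rule eventually_mono[rotated])
  ultimately have "\<bar>v x t - v x t'\<bar> \<le> L * \<sigma>up * \<bar>sqrt (t + 0) - sqrt (t' + 0)\<bar>"
    by (intro tendsto_le[OF trivial_limit_at_right_real])
  then show ?thesis by simp
qed

section \<open>One-sided derivatives of a supremum\<close>

text \<open>Danskin's argument, phrased through the planar set of pairs \<open>(a i, l i)\<close> so
  that the index set carries no topology. Compactness of the pairs yields a maximiser of
  \<open>a\<close> and keeps indices with too large a slope at a definite distance from the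
  optimum.\<close>

lemma parametric_sup_derivative:
  fixes a l :: "'i \<Rightarrow> real" and g :: "real \<Rightarrow> 'i \<Rightarrow> real"
  assumes I: "I \<noteq> {}" and cpt: "compact ((\<lambda>i. (a i, l i)) ` I)"
    and unif: "\<And>\<epsilon>. 0 < \<epsilon> \<Longrightarrow> \<forall>\<^sub>F h in at_right 0. \<forall>i\<in>I. \<bar>g h i - a i - h * l i\<bar> \<le> \<epsilon> * h"
  defines "M \<equiv> {i \<in> I. a i = (SUP i\<in>I. a i)}"
  shows "M \<noteq> {}" and "bounded (l ` I)"
    and "((\<lambda>h. ((SUP i\<in>I. g h i) - (SUP i\<in>I. a i)) / h) \<longlongrightarrow> (SUP i\<in>M. l i)) (at_right 0)"
proof -
  let ?P = "(\<lambda>i. (a i, l i)) ` I"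
  define A where "A = (SUP i\<in>I. a i)"
  define S where "S = (SUP i\<in>M. l i)"
  have "compact (fst ` ?P)" "compact (snd ` ?P)"
    by (intro compact_continuous_image continuous_intros cpt)+
  then have ca: "compact (a ` I)" and cl: "compact (l ` I)" by (simp_all add: image_image)
  show bl: "bounded (l ` I)" using cl by (rule compact_imp_bounded)
  then obtain C where C: "\<And>i. i \<in> I \<Longrightarrow> \<bar>l i\<bar> \<le> C" by (auto simp: bounded_iff)
  have bdd_a: "bdd_above (a ` I)" by (intro bounded_imp_bdd_above compact_imp_bounded ca)
  have a_le: "a i \<le> A" if "i \<in> I" for i unfolding A_def by (rule cSUP_upper[OF that bdd_a])
  obtain i0 where i0: "i0 \<in> I" "\<And>i. i \<in> I \<Longrightarrow> a i \<le> a i0"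
    using compact_attains_sup[OF ca] I by auto
  have "a i0 = A" using i0 I a_le unfolding A_def by (intro antisym cSUP_least) (auto simp: A_def)
  then show M: "M \<noteq> {}" using i0 by (auto simp: M_def A_def)
  have bdd_M: "bdd_above (l ` M)"
    using bl by (intro bounded_imp_bdd_above) (auto simp: M_def intro: bounded_subset)
  have l_le: "l i \<le> S" if "i \<in> M" for i unfolding S_def by (rule cSUP_upper[OF that bdd_M])
  have "((\<lambda>h. ((SUP i\<in>I. g h i) - A) / h) \<longlongrightarrow> S) (at_right 0)"
  proof (rule tendstoI)
    fix e :: real assume e: "0 < e"
    define \<epsilon> where "\<epsilon> = e / 3"
    have \<epsilon>: "0 < \<epsilon>" using e by (simp add: \<epsilon>_def)
    obtain j where j: "j \<in> M" "S - \<epsilon> < l j"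
      using less_cSUP_iff[OF M bdd_M, of "S - \<epsilon>"] \<epsilon> by (auto simp: S_def)
    \<comment> \<open>Among the indices with slope at least \<open>S + \<epsilon>\<close>,
      compactness lets \<open>a\<close> attain its largest value; that value is not
      \<open>A\<close>, since maximisers have slope at most \<open>S\<close>.\<close>
    have gap: "\<exists>\<delta>>0. \<forall>i\<in>I. S + \<epsilon> \<le> l i \<longrightarrow> a i \<le> A - \<delta>"
    proof (cases "\<exists>i\<in>I. S + \<epsilon> \<le> l i")
      case False
      then show ?thesis by (intro exI[of _ 1]) auto
    next
      case True
      define Q where "Q = ?P \<inter> {p. S + \<epsilon> \<le> snd p}"
      have "compact Q" unfolding Q_def
        by (intro compact_Int_closed cpt closed_Collect_le continuous_intros)
      then have "compact (fst ` Q)" by (intro compact_continuous_image continuous_intros)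
      moreover have "fst ` Q \<noteq> {}" using True by (auto simp: Q_def)
      ultimately obtain m where m: "m \<in> fst ` Q" "\<And>y. y \<in> fst ` Q \<Longrightarrow> y \<le> m"
        using compact_attains_sup by metis
      then obtain k where k: "k \<in> I" "m = a k" "S + \<epsilon> \<le> l k" by (auto simp: Q_def)
      have "a k \<noteq> A" using l_le[of k] k \<epsilon> by (auto simp: M_def A_def)
      then have "a k < A" using a_le k(1) by force
      moreover have "a i \<le> a k" if "i \<in> I" "S + \<epsilon> \<le> l i" for i
      proof -
        have "(a i, l i) \<in> Q" using that by (auto simp: Q_def)
        then show ?thesis using m(2)[of "a i"] k(2) by force
      qed
      ultimately show ?thesis by (intro exI[of _ "A - a k"]) auto
    qed
    then obtain \<delta> where \<delta>: "0 < \<delta>" "\<And>i. i \<in> I \<Longrightarrow> S + \<epsilon> \<le> l i \<Longrightarrow> a i \<le> A - \<delta>" by blast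
    \<comment> \<open>For such \<open>h\<close> the gain \<open>h * (l i - S)\<close> of a steep
      index stays below its deficit \<open>\<delta>\<close>.\<close>
    have "\<forall>\<^sub>F h in at_right 0. h < \<delta> / (\<bar>C\<bar> + \<bar>S\<bar> + 1)"
    proof -
      have "0 < \<delta> / (\<bar>C\<bar> + \<bar>S\<bar> + 1)" using \<delta>(1) by (intro divide_pos_pos add_nonneg_pos) auto
      from eventually_at_right_real[OF this] show ?thesis by eventually_elim simp
    qed
    moreover have "\<forall>\<^sub>F h in at_right (0::real). 0 < h" by (rule eventually_at_right_less)
    ultimately show "\<forall>\<^sub>F h in at_right 0. dist (((SUP i\<in>I. g h i) - A) / h) S < e"
      using unif[OF \<epsilon>]
    proof eventually_elim
      case (elim h)
      then have h: "0 < h" "h * (\<bar>C\<bar> + \<bar>S\<bar> + 1) < \<delta>" by (auto simp: field_simps)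
      have g: "g h i \<le> a i + h * l i + \<epsilon> * h" "a i + h * l i - \<epsilon> * h \<le> g h i" if "i \<in> I" for i
        using elim that by (auto simp: abs_le_iff algebra_simps)
      have up: "g h i \<le> A + h * (S + 2 * \<epsilon>)" if i: "i \<in> I" for i
      proof (cases "S + \<epsilon> \<le> l i")
        case True
        have "h * (l i - S) \<le> h * (\<bar>C\<bar> + \<bar>S\<bar> + 1)"
          using C[OF i] h(1) by (intro mult_left_mono) auto
        with h(2) have "h * l i \<le> h * S + \<delta>" by (simp add: algebra_simps)
        moreover have "0 \<le> h * \<epsilon>" using h \<epsilon> by simp
        ultimately show ?thesis using g(1)[OF i] \<delta>(2)[OF i True] by (simp add: algebra_simps)
      next
        case False
        then have "h * l i \<le> h * (S + \<epsilon>)" using h by (intro mult_left_mono) auto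
        then show ?thesis using g(1)[OF i] a_le[OF i] by (simp add: algebra_simps)
      qed
      then have "(SUP i\<in>I. g h i) \<le> A + h * (S + 2 * \<epsilon>)" by (intro cSUP_least I)
      then have "((SUP i\<in>I. g h i) - A) / h \<le> S + 2 * \<epsilon>" using h by (simp add: field_simps)
      \<comment> \<open>From below it suffices to test the supremum with the maximiser
        \<open>j\<close>, whose slope exceeds \<open>S - \<epsilon>\<close>.\<close>
      moreover have "S - 2 * \<epsilon> \<le> ((SUP i\<in>I. g h i) - A) / h"
      proof -
        have jI: "j \<in> I" "a j = A" using j by (auto simp: M_def A_def)
        have "h * (S - \<epsilon>) \<le> h * l j" using j h by (intro mult_left_mono) auto
        then have "A + h * (S - 2 * \<epsilon>) \<le> g h j" using g(2)[OF jI(1)] jI by (simp add: algebra_simps)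
        also have "g h j \<le> (SUP i\<in>I. g h i)" using up by (intro cSUP_upper jI bdd_aboveI2)
        finally show ?thesis using h by (simp add: field_simps)
      qed
      ultimately show ?case using \<epsilon> by (auto simp: dist_real_def \<epsilon>_def abs_less_iff)
    qed
  qed
  then show "((\<lambda>h. ((SUP i\<in>I. g h i) - (SUP i\<in>I. a i)) / h) \<longlongrightarrow> (SUP i\<in>M. l i)) (at_right 0)"
    by (simp add: A_def S_def)
qed

text \<open>
  The integrals of the difference quotients telescope to difference quotients of an antiderivative,
  so no differentiation theorem for Lipschitz functions is needed.
\<close>

lemma lipschitz_difference_quotient_FTC:
  fixes F D :: "real \<Rightarrow> real"
  assumes ab: "p < a" "a \<le> b" "b < q"
    and lip: "K-lipschitz_on {p..q} F"
    and h: "h \<longlonglongrightarrow> 0" "\<And>n. h n \<noteq> 0"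
    and lim: "\<And>s. s \<in> {a..b} \<Longrightarrow> (\<lambda>n. (F (s + h n) - F s) / h n) \<longlonglongrightarrow> D s"
  shows "set_integrable lborel {a..b} D" and "(LINT s:{a..b}|lborel. D s) = F b - F a"
proof -
  have contF: "continuous_on {p..q} F" using lip by (rule lipschitz_on_continuous_on)
  obtain g where g: "\<And>x. x \<in> {p..q} \<Longrightarrow> (g has_vector_derivative F x) (at x within {p..q})"
    using antiderivative_continuous[OF contF] by blast
  have g': "(g has_real_derivative F x) (at x)" if "p < x" "x < q" for x
    using g[of x] that at_within_interior[of x "{p..q}"]
    by (simp add: has_real_derivative_iff_has_vector_derivative)
  define \<delta> where "\<delta> = min (a - p) (q - b)"
  have \<delta>: "0 < \<delta>" using ab by (simp add: \<delta>_def)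
  obtain N where N: "\<And>n. n \<ge> N \<Longrightarrow> \<bar>h n\<bar> < \<delta>"
    using h(1)[THEN tendstoD, OF \<delta>] by (auto simp: eventually_sequentially)
  \<comment> \<open>Dropping finitely many terms keeps \<open>s + k n\<close> between
    \<open>p\<close> and \<open>q\<close> for every \<open>s\<close> in \<open>{a..b}\<close>,
    uniformly in \<open>s\<close>.\<close>
  define k where "k n = h (n + N)" for n
  have k: "k \<longlonglongrightarrow> 0" "\<And>n. k n \<noteq> 0" "\<And>n. \<bar>k n\<bar> < \<delta>"
    using LIMSEQ_ignore_initial_segment[OF h(1), of N] h(2) N by (simp_all add: k_def[abs_def])
  have limk: "(\<lambda>n. (F (s + k n) - F s) / k n) \<longlonglongrightarrow> D s" if "s \<in> {a..b}" for s
    using LIMSEQ_ignore_initial_segment[OF lim[OF that], of N] by (simp add: k_def)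
  have in_pq: "p < s" "s < q" "p < s + k n" "s + k n < q" if "s \<in> {a..b}" for s n
    using that k(3)[of n] ab by (auto simp: \<delta>_def)
  have contq: "continuous_on {a..b} (\<lambda>s. (F (s + k n) - F s) / k n)" for n
  proof -
    have "continuous_on {a..b} (\<lambda>s. F (s + k n))"
      by (rule continuous_on_compose2[OF contF])
        (use in_pq in \<open>auto intro!: continuous_intros less_imp_le\<close>)
    moreover have "continuous_on {a..b} F"
      by (rule continuous_on_subset[OF contF]) (use ab in auto)
    ultimately show ?thesis using k(2) by (intro continuous_intros ballI)
  qed
  have intq: "(LINT s:{a..b}|lborel. (F (s + k n) - F s) / k n) =
      (g (b + k n) - g b) / k n - (g (a + k n) - g a) / k n" for n
  proof -
    have "((\<lambda>s. (F (s + k n) - F s) / k n) has_integral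
        (g (b + k n) - g b) / k n - (g (a + k n) - g a) / k n) {a..b}"
    proof (rule fundamental_theorem_of_calculus[OF ab(2)])
      fix s assume s: "s \<in> {a..b}"
      have "((\<lambda>s. (g (s + k n) - g s) / k n) has_real_derivative (F (s + k n) - F s) / k n) (at s)"
        by (intro DERIV_cdivide DERIV_diff g' in_pq[OF s] DERIV_shift[THEN iffD1])
      then show "((\<lambda>s. (g (s + k n) - g s) / k n) has_vector_derivative (F (s + k n) - F s) / k n)
          (at s within {a..b})"
        by (simp add: has_real_derivative_iff_has_vector_derivative has_vector_derivative_at_within)
    qed
    then show ?thesis
      using set_borel_integral_eq_integral(2)[OF borel_integrable_atLeastAtMost'[OF contq[of n]]]
      by (metis integral_unique)
  qed
  have limg: "(\<lambda>n. (g (x + k n) - g x) / k n) \<longlonglongrightarrow> F x" if "x \<in> {a..b}" for x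
  proof -
    have "(\<lambda>h. (g (x + h) - g x) / h) \<midarrow>0\<rightarrow> F x"
      using g'[of x] in_pq(1,2)[OF that] by (simp add: DERIV_def)
    moreover have "filterlim k (at 0) sequentially"
      using k by (simp add: filterlim_at)
    ultimately show ?thesis by (rule filterlim_compose)
  qed
  have bound: "\<bar>(F (s + k n) - F s) / k n\<bar> \<le> K" if "s \<in> {a..b}" for s n
    using lipschitz_onD[OF lip, of "s + k n" s] in_pq(1,2)[OF that] in_pq(3,4)[OF that, of n] k(2)[of n]
    by (simp add: dist_real_def field_simps)
  define i where "i n s = indicator {a..b} s *\<^sub>R ((F (s + k n) - F s) / k n)" for n s
  have im: "i n \<in> borel_measurable lborel" for n
    using borel_integrable_atLeastAtMost'[OF contq[of n]]
    by (auto simp: i_def[abs_def] set_integrable_def)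
  have il: "(\<lambda>n. i n s) \<longlonglongrightarrow> indicator {a..b} s *\<^sub>R D s" for s
    using limk[of s] by (cases "s \<in> {a..b}") (auto simp: i_def)
  have Dm: "(\<lambda>s. indicator {a..b} s *\<^sub>R D s) \<in> borel_measurable lborel"
    by (rule borel_measurable_LIMSEQ_metric[OF im il])
  have dom: "integrable lborel (\<lambda>s. indicator {a..b} s *\<^sub>R K)"
    using borel_integrable_atLeastAtMost'[of a b "\<lambda>_. K"] by (simp add: set_integrable_def)
  have i_le: "norm (i n s) \<le> indicator {a..b} s *\<^sub>R K" for n s
    using bound[of s n] by (auto simp: i_def indicator_def)
  have dct: "integrable lborel (\<lambda>s. indicator {a..b} s *\<^sub>R D s)"
     "(\<lambda>n. integral\<^sup>L lborel (i n)) \<longlonglongrightarrow> (LINT s|lborel. indicator {a..b} s *\<^sub>R D s)"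
    by (rule integrable_dominated_convergence[OF Dm im dom AE_I2[OF il] AE_I2[OF i_le]]
        integral_dominated_convergence[OF Dm im dom AE_I2[OF il] AE_I2[OF i_le]])+
  show "set_integrable lborel {a..b} D" using dct(1) by (simp add: set_integrable_def)
  have "(\<lambda>n. integral\<^sup>L lborel (i n)) \<longlonglongrightarrow> F b - F a"
    using tendsto_diff[OF limg[of b] limg[of a]] ab
    by (simp add: i_def[abs_def] flip: intq) (simp add: set_lebesgue_integral_def)
  then show "(LINT s:{a..b}|lborel. D s) = F b - F a"
    using dct(2) LIMSEQ_unique by (auto simp: set_lebesgue_integral_def)
qed

lemma difference_quotient_FTC:
  fixes F D \<gamma> \<gamma>' :: "real \<Rightarrow> real"
  assumes pq: "p < q"
    and control: "\<And>s s'. p \<le> s \<Longrightarrow> s \<le> s' \<Longrightarrow> s' \<le> q \<Longrightarrow> \<bar>F s' - F s\<bar> \<le> \<gamma> s' - \<gamma> s"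
    and \<gamma>: "continuous_on {p..q} \<gamma>"
    and \<gamma>': "\<And>s. s \<in> {p<..<q} \<Longrightarrow> (\<gamma> has_real_derivative \<gamma>' s) (at s)" "continuous_on {p<..<q} \<gamma>'"
    and h: "h \<longlonglongrightarrow> 0" "\<And>n. h n \<noteq> 0"
    and lim: "\<And>s. s \<in> {p<..<q} \<Longrightarrow> (\<lambda>n. (F (s + h n) - F s) / h n) \<longlonglongrightarrow> D s"
  shows "set_integrable lborel {p<..<q} D" and "(LINT s:{p<..<q}|lborel. D s) = F q - F p"
proof -
  have control': "\<bar>F s' - F s\<bar> \<le> \<bar>\<gamma> s' - \<gamma> s\<bar>" if "s \<in> {p..q}" "s' \<in> {p..q}" for s s'
    using control[of s s'] control[of s' s] that by (cases "s \<le> s'") auto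
  have contF: "continuous_on {p..q} F"
    unfolding continuous_on_iff
  proof (intro ballI allI impI)
    fix s and e :: real assume s: "s \<in> {p..q}" "0 < e"
    then obtain d where d: "d > 0" "\<And>s'. s' \<in> {p..q} \<Longrightarrow> dist s' s < d \<Longrightarrow> dist (\<gamma> s') (\<gamma> s) < e"
      using \<gamma> unfolding continuous_on_iff by blast
    show "\<exists>d>0. \<forall>s'\<in>{p..q}. dist s' s < d \<longrightarrow> dist (F s') (F s) < e"
    proof (intro exI[of _ d] conjI ballI impI d(1))
      fix s' assume "s' \<in> {p..q}" "dist s' s < d"
      then show "dist (F s') (F s) < e"
        using d(2)[of s'] control'[OF s(1), of s'] by (simp add: dist_real_def)
    qed
  qed
  have hlim: "filterlim h (at 0) sequentially" using h by (simp add: filterlim_at)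
  have D_le: "\<bar>D s\<bar> \<le> \<gamma>' s" if s: "s \<in> {p<..<q}" for s
  proof -
    have "(\<lambda>x. (\<gamma> (s + x) - \<gamma> s) / x) \<midarrow>0\<rightarrow> \<gamma>' s" using \<gamma>'(1)[OF s] by (simp add: DERIV_def)
    then have "(\<lambda>n. (\<gamma> (s + h n) - \<gamma> s) / h n) \<longlonglongrightarrow> \<gamma>' s" by (rule filterlim_compose[OF _ hlim])
    moreover have "(\<lambda>n. \<bar>(F (s + h n) - F s) / h n\<bar>) \<longlonglongrightarrow> \<bar>D s\<bar>"
      by (intro tendsto_intros lim s)
    \<comment> \<open>By \<open>control\<close>, \<open>\<gamma>\<close> is nondecreasing on
      \<open>{p..q}\<close>, so its quotient is nonnegative for either sign of
      \<open>h n\<close>.\<close>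
    moreover have "\<forall>\<^sub>F n in sequentially. \<bar>(F (s + h n) - F s) / h n\<bar> \<le> (\<gamma> (s + h n) - \<gamma> s) / h n"
    proof -
      have "(\<lambda>n. s + h n) \<longlonglongrightarrow> s + 0" by (intro tendsto_intros h)
      then have "\<forall>\<^sub>F n in sequentially. s + h n \<in> {p<..<q}"
        using s by (intro topological_tendstoD) auto
      then show ?thesis
      proof eventually_elim
        case (elim n)
        show ?case
          using control[of s "s + h n"] control[of "s + h n" s] elim s h(2)[of n]
          by (cases "h n" "0::real" rule: linorder_cases) (auto simp: field_simps abs_minus_commute)
      qed
    qed
    ultimately show ?thesis by (intro tendsto_le[OF sequentially_bot])
  qed
  have \<gamma>'_nonneg: "0 \<le> \<gamma>' s" if "s \<in> {p<..<q}" for s using D_le[OF that] by linarith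
  have eint: "einterval (ereal p) (ereal q) = {p<..<q}" by (auto simp: einterval_iff)
  \<comment> \<open>A nonnegative derivative is integrable as soon as its antiderivative has finite
    limits at both ends, even if it blows up there.\<close>
  have \<gamma>'_int: "set_integrable lborel {p<..<q} \<gamma>'"
    unfolding eint[symmetric]
  proof (rule interval_integral_FTC_nonneg(1)[where F = \<gamma> and A = "\<gamma> p" and B = "\<gamma> q"])
    show "((\<gamma> \<circ> real_of_ereal) \<longlongrightarrow> \<gamma> p) (at_right (ereal p))"
      using \<gamma> pq by (simp add: continuous_on_Icc_at_rightD ereal_tendsto_simps)
    show "((\<gamma> \<circ> real_of_ereal) \<longlongrightarrow> \<gamma> q) (at_left (ereal q))"
      using \<gamma> pq by (simp add: continuous_on_Icc_at_leftD ereal_tendsto_simps)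
    show "isCont \<gamma>' x" if "ereal p < ereal x" "ereal x < ereal q" for x
      using \<gamma>'(2) that by (simp add: continuous_on_eq_continuous_at)
  qed (use pq \<gamma>' \<gamma>'_nonneg in auto)
  \<comment> \<open>The offset 3 removes at most a third of the interval at each end, which ensures
    \<open>a n < b n\<close> for every \<open>n\<close>.\<close>
  define a where "a n = p + (q - p) / (real n + 3)" for n
  define b where "b n = q - (q - p) / (real n + 3)" for n
  have small: "0 < (q - p) / (real n + 3)" "(q - p) / (real n + 3) \<le> (q - p) / 3" for n
    using pq divide_left_mono[of 3 "real n + 3" "q - p"] by simp_all
  have ab: "p < a n" "a n < b n" "b n < q" for n
  proof -
    have "p < p + r \<and> p + r < q - r \<and> q - r < q" if "0 < r" "r \<le> (q - p) / 3" for r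
      using that by auto
    from this[OF small[of n]] show "p < a n" "a n < b n" "b n < q" by (auto simp: a_def b_def)
  qed
  have z: "(\<lambda>n. (q - p) / (real n + 3)) \<longlonglongrightarrow> 0" by real_asymp
  have alim: "a \<longlonglongrightarrow> p" using tendsto_add[OF tendsto_const z, of p] by (simp add: a_def[abs_def])
  have blim: "b \<longlonglongrightarrow> q" using tendsto_diff[OF tendsto_const z, of q] by (simp add: b_def[abs_def])
  have loc: "set_integrable lborel {a n..b n} D" "(LINT s:{a n..b n}|lborel. D s) = F (b n) - F (a n)" for n
  proof -
    \<comment> \<open>The midpoints leave room for increments around \<open>{a n..b n}\<close> and
      still bound a compact interval inside \<open>{p<..<q}\<close>, where \<open>\<gamma>'\<close>
      is bounded.\<close>
    define p' q' where "p' = (p + a n) / 2" and "q' = (b n + q) / 2"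
    have pq': "p < p'" "p' < a n" "b n < q'" "q' < q" using ab[of n] by (auto simp: p'_def q'_def)
    have "compact (\<gamma>' ` {p'..q'})"
      by (intro compact_continuous_image continuous_on_subset[OF \<gamma>'(2)]) (use pq' in auto)
    then have "bounded (\<gamma>' ` {p'..q'})" by (rule compact_imp_bounded)
    then obtain K where K: "0 < K" "\<And>s. s \<in> {p'..q'} \<Longrightarrow> \<bar>\<gamma>' s\<bar> \<le> K"
      by (auto simp: bounded_pos)
    have "K-lipschitz_on {p'..q'} F"
    proof (rule lipschitz_onI)
      fix s s' assume ss: "s \<in> {p'..q'}" "s' \<in> {p'..q'}"
      have "norm (\<gamma> s - \<gamma> s') \<le> K * norm (s - s')"
      proof (rule field_differentiable_bound[OF convex_real_interval(5)])
        show "(\<gamma> has_field_derivative \<gamma>' r) (at r within {p'..q'})" if "r \<in> {p'..q'}" for r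
          using \<gamma>'(1)[of r] that pq' by (auto intro: DERIV_subset)
      qed (use K ss in auto)
      moreover have "\<bar>F s - F s'\<bar> \<le> \<bar>\<gamma> s - \<gamma> s'\<bar>" using ss pq' by (intro control') auto
      ultimately show "dist (F s) (F s') \<le> K * dist s s'" by (simp add: dist_real_def)
    qed (use K in auto)
    moreover have "(\<lambda>n. (F (s + h n) - F s) / h n) \<longlonglongrightarrow> D s" if "s \<in> {a n..b n}" for s
      using that ab[of n] by (intro lim) auto
    ultimately show "set_integrable lborel {a n..b n} D"
        "(LINT s:{a n..b n}|lborel. D s) = F (b n) - F (a n)"
      using lipschitz_difference_quotient_FTC[OF pq'(2) less_imp_le[OF ab(2)] pq'(3) _ h] by blast+
  qed
  \<comment> \<open>The intervals \<open>{a n..b n}\<close> exhaust \<open>{p<..<q}\<close>;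
    dominated convergence with majorant \<open>\<gamma>'\<close> passes to the limit.\<close>
  define i where "i n s = indicator {a n..b n} s *\<^sub>R D s" for n s
  have im: "i n \<in> borel_measurable lborel" for n
    using loc(1)[of n] by (auto simp: i_def[abs_def] set_integrable_def)
  have il: "(\<lambda>n. i n s) \<longlonglongrightarrow> indicator {p<..<q} s *\<^sub>R D s" for s
  proof (cases "s \<in> {p<..<q}")
    case True
    then have "\<forall>\<^sub>F n in sequentially. a n < s" "\<forall>\<^sub>F n in sequentially. s < b n"
      using order_tendstoD[OF alim] order_tendstoD[OF blim] by auto
    then have "\<forall>\<^sub>F n in sequentially. i n s = indicator {p<..<q} s *\<^sub>R D s"
      by eventually_elim (use True in \<open>auto simp: i_def\<close>)
    then show ?thesis by (rule tendsto_eventually)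
  next
    case False
    then have "i n s = 0" for n using ab[of n] by (auto simp: i_def indicator_def)
    then show ?thesis using False by simp
  qed
  have Dm: "(\<lambda>s. indicator {p<..<q} s *\<^sub>R D s) \<in> borel_measurable lborel"
    by (rule borel_measurable_LIMSEQ_metric[OF im il])
  have dom: "integrable lborel (\<lambda>s. indicator {p<..<q} s *\<^sub>R \<gamma>' s)"
    using \<gamma>'_int by (simp add: set_integrable_def)
  have i_le: "norm (i n s) \<le> indicator {p<..<q} s *\<^sub>R \<gamma>' s" for n s
    using D_le[of s] ab[of n] by (auto simp: i_def indicator_def)
  have dct: "integrable lborel (\<lambda>s. indicator {p<..<q} s *\<^sub>R D s)"
     "(\<lambda>n. integral\<^sup>L lborel (i n)) \<longlonglongrightarrow> (LINT s|lborel. indicator {p<..<q} s *\<^sub>R D s)"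
    by (rule integrable_dominated_convergence[OF Dm im dom AE_I2[OF il] AE_I2[OF i_le]]
        integral_dominated_convergence[OF Dm im dom AE_I2[OF il] AE_I2[OF i_le]])+
  show "set_integrable lborel {p<..<q} D" using dct(1) by (simp add: set_integrable_def)
  have "a n \<in> {p..q}" "b n \<in> {p..q}" for n using ab[of n] by auto
  then have "(\<lambda>n. F (b n)) \<longlonglongrightarrow> F q" "(\<lambda>n. F (a n)) \<longlonglongrightarrow> F p"
    using pq by (intro continuous_on_tendsto_compose[OF contF] alim blim always_eventually; simp)+
  then have "(\<lambda>n. integral\<^sup>L lborel (i n)) \<longlonglongrightarrow> F q - F p"
    using tendsto_diff by (fastforce simp: i_def[abs_def] set_lebesgue_integral_def simp flip: loc(2))
  then show "(LINT s:{p<..<q}|lborel. D s) = F q - F p"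
    using dct(2) LIMSEQ_unique by (auto simp: set_lebesgue_integral_def)
qed

section \<open>Integrals over a weakly compact family\<close>

lemma topspace_weak_topology: "topspace weak_topology = borel_probs"
proof -
  have "borel_probs = {\<mu> \<in> borel_probs. (LINT x|\<mu>. 0) \<in> (UNIV :: real set)}" by simp
  then have "borel_probs \<in> {{\<mu> \<in> borel_probs. (LINT x|\<mu>. f x) \<in> U} | (f :: real \<Rightarrow> real) (U :: real set).
        continuous_on UNIV f \<and> bounded (range f) \<and> open U}"
    by (intro CollectI exI[of _ "\<lambda>_. 0"] exI[of _ UNIV]) auto
  then show ?thesis unfolding weak_topology_def topology_generated_by_topspace by blast
qed

lemma continuous_map_weak_integral:
  fixes f :: "real \<Rightarrow> real"
  assumes "continuous_on UNIV f" "bounded (range f)"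
  shows "continuous_map weak_topology euclideanreal (\<lambda>\<mu>. LINT x|\<mu>. f x)"
  unfolding continuous_map_def
proof (intro conjI allI impI)
  fix U :: "real set" assume U: "openin euclidean U"
  have "openin weak_topology {\<mu> \<in> borel_probs. (LINT x|\<mu>. f x) \<in> U}"
    unfolding weak_topology_def using assms U
    by (intro topology_generated_by_Basis CollectI exI[of _ f] exI[of _ U]) auto
  then show "openin weak_topology {\<mu> \<in> topspace weak_topology. (LINT x|\<mu>. f x) \<in> U}"
    by (simp add: topspace_weak_topology)
qed simp

text \<open>\<open>UI\<close> is uniform integrability of \<open>\<bar>x\<bar>\<close> over
  \<open>\<Theta>\<close>; it lets integrands of linear growth be handled almost like bounded
  ones.\<close>

locale weakly_compact_UI =
  fixes \<Theta> :: "real measure set"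
  assumes nonempty: "\<Theta> \<noteq> {}" and probs: "\<Theta> \<subseteq> borel_probs" and cpt: "compactin weak_topology \<Theta>"
    and UI: "((\<lambda>N::real. nn_upper_exp \<Theta> (\<lambda>x. ennreal \<bar>x\<bar> * indicator {y. \<bar>y\<bar> > N} x)) \<longlongrightarrow> 0) at_top"
begin

lemma prob_space: "\<mu> \<in> \<Theta> \<Longrightarrow> prob_space \<mu>"
  and sets_eq [measurable_cong]: "\<mu> \<in> \<Theta> \<Longrightarrow> sets \<mu> = sets borel"
  using probs by (auto simp: borel_probs_def)

lemma continuous_imp_measurable:
  fixes f :: "real \<Rightarrow> real"
  assumes "\<mu> \<in> \<Theta>" "continuous_on UNIV f" shows "f \<in> borel_measurable \<mu>"
  using borel_measurable_continuous_onI[OF assms(2)]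
  by (simp add: measurable_cong_sets[OF sets_eq[OF assms(1)] refl])

text \<open>Turns the extended tail condition into Bochner integrals, whose integrability comes from
  finiteness of the tail. The bound \<open>1 \<le> N\<close> lets \<open>1 + \<bar>x\<bar>\<close>
  be absorbed into \<open>2 * \<bar>x\<bar>\<close> on the tail.\<close>

lemma tail:
  assumes "0 < \<epsilon>"
  obtains N where "1 \<le> N"
    "\<And>\<mu>. \<mu> \<in> \<Theta> \<Longrightarrow> integrable \<mu> (\<lambda>x. \<bar>x\<bar> * indicator {y. N < \<bar>y\<bar>} x)"
    "\<And>\<mu>. \<mu> \<in> \<Theta> \<Longrightarrow> (LINT x|\<mu>. \<bar>x\<bar> * indicator {y. N < \<bar>y\<bar>} x) \<le> \<epsilon>"
proof -
  have "\<forall>\<^sub>F N in at_top. nn_upper_exp \<Theta> (\<lambda>x. ennreal \<bar>x\<bar> * indicator {y. \<bar>y\<bar> > N} x) < ennreal \<epsilon>"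
    using order_tendstoD(2)[OF UI, of "ennreal \<epsilon>"] assms by simp
  from eventually_conj[OF this eventually_ge_at_top[of 1]]
  obtain N :: real where N: "nn_upper_exp \<Theta> (\<lambda>x. ennreal \<bar>x\<bar> * indicator {y. \<bar>y\<bar> > N} x) < ennreal \<epsilon>" "1 \<le> N"
    using eventually_happens'[OF trivial_limit_at_top_linorder] by blast
  have *: "integrable \<mu> (\<lambda>x. \<bar>x\<bar> * indicator {y. N < \<bar>y\<bar>} x) \<and>
      (LINT x|\<mu>. \<bar>x\<bar> * indicator {y. N < \<bar>y\<bar>} x) \<le> \<epsilon>" if \<mu>: "\<mu> \<in> \<Theta>" for \<mu>
  proof -
    interpret prob_space \<mu> using prob_space[OF \<mu>] .
    note [measurable_cong] = sets_eq[OF \<mu>]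
    have eq: "(\<integral>\<^sup>+x. ennreal (\<bar>x\<bar> * indicator {y. N < \<bar>y\<bar>} x) \<partial>\<mu>) =
        (\<integral>\<^sup>+x. ennreal \<bar>x\<bar> * indicator {y. N < \<bar>y\<bar>} x \<partial>\<mu>)"
      by (intro nn_integral_cong) (auto simp: indicator_def)
    have le: "(\<integral>\<^sup>+x. ennreal (\<bar>x\<bar> * indicator {y. N < \<bar>y\<bar>} x) \<partial>\<mu>) \<le> ennreal \<epsilon>"
      unfolding eq using N(1) \<mu> unfolding nn_upper_exp_def
      by (intro order_trans[OF SUP_upper less_imp_le])
    have meas: "(\<lambda>x. \<bar>x\<bar> * indicator {y. N < \<bar>y\<bar>} x) \<in> borel_measurable \<mu>"
      unfolding measurable_cong_sets[OF sets_eq[OF \<mu>] refl] by measurable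
    have 1: "integrable \<mu> (\<lambda>x. \<bar>x\<bar> * indicator {y. N < \<bar>y\<bar>} x)"
      by (rule integrableI_nonneg[OF meas]) (use le in \<open>auto simp: top_unique intro: le_less_trans\<close>)
    have "(LINT x|\<mu>. \<bar>x\<bar> * indicator {y. N < \<bar>y\<bar>} x) \<le> \<epsilon>"
      using le assms by (subst (asm) nn_integral_eq_integral[OF 1]) (auto simp: ennreal_le_iff)
    with 1 show ?thesis by blast
  qed
  show ?thesis by (rule that[OF N(2)]) (use * in blast)+
qed

lemma integrable_abs:
  assumes "\<mu> \<in> \<Theta>" shows "integrable \<mu> (\<lambda>x. \<bar>x\<bar>)"
proof -
  interpret prob_space \<mu> using prob_space[OF assms] .
  obtain N where N: "1 \<le> N"
    "\<And>\<mu>. \<mu> \<in> \<Theta> \<Longrightarrow> integrable \<mu> (\<lambda>x. \<bar>x\<bar> * indicator {y. N < \<bar>y\<bar>} x)"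
    "\<And>\<mu>. \<mu> \<in> \<Theta> \<Longrightarrow> (LINT x|\<mu>. \<bar>x\<bar> * indicator {y. N < \<bar>y\<bar>} x) \<le> 1"
    by (rule tail[OF zero_less_one]) (rule that; blast)
  have "integrable \<mu> (\<lambda>x. N + \<bar>x\<bar> * indicator {y. N < \<bar>y\<bar>} x)"
    by (intro Bochner_Integration.integrable_add integrable_const assms N(2))
  then show ?thesis
    by (rule Bochner_Integration.integrable_bound)
      (use N(1) in \<open>auto simp: indicator_def intro!: continuous_imp_measurable[OF assms] continuous_intros\<close>)
qed

lemma integrable_linear_growth:
  fixes f :: "real \<Rightarrow> real"
  assumes "\<mu> \<in> \<Theta>" "continuous_on UNIV f" "\<And>x. \<bar>f x\<bar> \<le> C * (1 + \<bar>x\<bar>)"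
  shows "integrable \<mu> f"
proof -
  interpret prob_space \<mu> using prob_space[OF assms(1)] .
  have "integrable \<mu> (\<lambda>x. C * (1 + \<bar>x\<bar>))"
    by (intro integrable_mult_right Bochner_Integration.integrable_add integrable_const integrable_abs assms)
  then show ?thesis
    by (rule Bochner_Integration.integrable_bound)
      (use assms in \<open>auto intro!: continuous_imp_measurable intro: order_trans[OF _ abs_ge_self]\<close>)
qed

lemma moment_bound: obtains m where "0 \<le> m" "\<And>\<mu>. \<mu> \<in> \<Theta> \<Longrightarrow> (LINT x|\<mu>. \<bar>x\<bar>) \<le> m"
proof -
  obtain N where N: "1 \<le> N"
      "\<And>\<mu>. \<mu> \<in> \<Theta> \<Longrightarrow> integrable \<mu> (\<lambda>x. \<bar>x\<bar> * indicator {y. N < \<bar>y\<bar>} x)"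
      "\<And>\<mu>. \<mu> \<in> \<Theta> \<Longrightarrow> (LINT x|\<mu>. \<bar>x\<bar> * indicator {y. N < \<bar>y\<bar>} x) \<le> 1"
    by (rule tail[OF zero_less_one]) (rule that; blast)
  show ?thesis
  proof (rule that[of "N + 1"])
    fix \<mu> assume \<mu>: "\<mu> \<in> \<Theta>"
    interpret prob_space \<mu> using prob_space[OF \<mu>] .
    have "(LINT x|\<mu>. \<bar>x\<bar>) \<le> (LINT x|\<mu>. N + \<bar>x\<bar> * indicator {y. N < \<bar>y\<bar>} x)"
      using N(1) by (intro integral_mono integrable_abs \<mu> Bochner_Integration.integrable_add integrable_const N(2))
        (auto simp: indicator_def)
    also have "\<dots> = N + (LINT x|\<mu>. \<bar>x\<bar> * indicator {y. N < \<bar>y\<bar>} x)"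
      by (subst Bochner_Integration.integral_add) (auto intro: N(2) \<mu> simp: prob_space)
    finally show "(LINT x|\<mu>. \<bar>x\<bar>) \<le> N + 1" using N(3)[OF \<mu>] by simp
  qed (use N in auto)
qed

text \<open>The weak topology tests bounded integrands only. Clipping \<open>f\<close> at height
  \<open>C * (1 + n)\<close> alters it only where \<open>\<bar>x\<bar> > n\<close>, and the tails
  are small uniformly over \<open>\<Theta>\<close>, so the map is a uniform limit of continuous
  ones.\<close>

lemma continuous_map_integral_linear_growth:
  fixes f :: "real \<Rightarrow> real"
  assumes f: "continuous_on UNIV f" "\<And>x. \<bar>f x\<bar> \<le> C * (1 + \<bar>x\<bar>)"
  shows "continuous_map (subtopology weak_topology \<Theta>) euclideanreal (\<lambda>\<mu>. LINT x|\<mu>. f x)"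
proof -
  have C: "0 \<le> C" using f(2)[of 0] by simp
  define clip where "clip n x = max (- (C * (1 + real n))) (min (C * (1 + real n)) (f x))" for n x
  have clip_cont: "continuous_on UNIV (clip n)" for n
    unfolding clip_def by (intro continuous_intros f)
  have clamp: "\<bar>max (- K) (min K y)\<bar> \<le> K" "\<bar>max (- K) (min K y) - y\<bar> \<le> \<bar>y\<bar>" if "0 \<le> K" for K y :: real
    using that by (auto simp: max_def min_def)
  have clip_bdd: "\<bar>clip n x\<bar> \<le> C * (1 + real n)" for n x
    unfolding clip_def using C by (intro clamp) simp
  have "continuous_map (subtopology weak_topology \<Theta>) Met_TC.mtopology (\<lambda>\<mu>. LINT x|\<mu>. f x)"
  proof (rule Met_TC.continuous_map_uniform_limit[where F = sequentially and f = "\<lambda>n \<mu>. LINT x|\<mu>. clip n x"])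
    have "bounded (range (clip n))" for n using clip_bdd by (auto simp: bounded_iff)
    then show "\<forall>\<^sub>F n in sequentially. continuous_map (subtopology weak_topology \<Theta>)
        Met_TC.mtopology (\<lambda>\<mu>. LINT x|\<mu>. clip n x)"
      by (intro always_eventually allI)
        (simp add: continuous_map_from_subtopology continuous_map_weak_integral clip_cont)
  next
    \<comment> \<open>The clipping error will be at most \<open>2 * C\<close> times the tail; the
      denominator \<open>4 * C + 4\<close> makes this smaller than \<open>\<epsilon>\<close> and is
      positive even for \<open>C = 0\<close>.\<close>
    fix \<epsilon> :: real assume \<epsilon>: "0 < \<epsilon>"
    then have \<epsilon>': "0 < \<epsilon> / (4 * C + 4)" using C by simp
    obtain N where N: "1 \<le> N"
      "\<And>\<mu>. \<mu> \<in> \<Theta> \<Longrightarrow> integrable \<mu> (\<lambda>x. \<bar>x\<bar> * indicator {y. N < \<bar>y\<bar>} x)"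
      "\<And>\<mu>. \<mu> \<in> \<Theta> \<Longrightarrow> (LINT x|\<mu>. \<bar>x\<bar> * indicator {y. N < \<bar>y\<bar>} x) \<le> \<epsilon> / (4 * C + 4)"
      by (rule tail[OF \<epsilon>']) (rule that; blast)
    have close: "\<bar>(LINT x|\<mu>. clip n x) - (LINT x|\<mu>. f x)\<bar> < \<epsilon>" if \<mu>: "\<mu> \<in> \<Theta>" and n: "N \<le> real n" for \<mu> n
    proof -
      interpret prob_space \<mu> using prob_space[OF \<mu>] .
      have ic: "integrable \<mu> (clip n)"
        using clip_bdd by (intro integrable_const_bound[of _ "C * (1 + real n)"])
          (auto intro!: continuous_imp_measurable \<mu> clip_cont)
      have i_f: "integrable \<mu> f" by (rule integrable_linear_growth[OF \<mu> f])
      have pt: "\<bar>clip n x - f x\<bar> \<le> 2 * C * (\<bar>x\<bar> * indicator {y. N < \<bar>y\<bar>} x)" for x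
      proof (cases "N < \<bar>x\<bar>")
        case True
        have "C * (1 + \<bar>x\<bar>) \<le> C * (2 * \<bar>x\<bar>)" using True N(1) C by (intro mult_left_mono) auto
        moreover have "\<bar>clip n x - f x\<bar> \<le> \<bar>f x\<bar>"
          unfolding clip_def using C by (intro clamp) simp
        ultimately show ?thesis using f(2)[of x] True by (simp add: algebra_simps)
      next
        case False
        have "C * (1 + \<bar>x\<bar>) \<le> C * (1 + real n)" using False n C by (intro mult_left_mono) auto
        then have "\<bar>f x\<bar> \<le> C * (1 + real n)" using f(2)[of x] by linarith
        then have "clip n x = f x" unfolding clip_def by linarith
        then show ?thesis using False by simp
      qed
      have "\<bar>(LINT x|\<mu>. clip n x) - (LINT x|\<mu>. f x)\<bar> = \<bar>LINT x|\<mu>. clip n x - f x\<bar>"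
        by (simp add: Bochner_Integration.integral_diff[OF ic i_f])
      also have "\<dots> \<le> (LINT x|\<mu>. \<bar>clip n x - f x\<bar>)" by (rule integral_abs_bound)
      also have "\<dots> \<le> (LINT x|\<mu>. 2 * C * (\<bar>x\<bar> * indicator {y. N < \<bar>y\<bar>} x))"
        by (intro integral_mono integrable_mult_right N(2) \<mu> integrable_abs[unfolded] pt
            Bochner_Integration.integrable_abs Bochner_Integration.integrable_diff ic i_f)
      also have "\<dots> = 2 * C * (LINT x|\<mu>. \<bar>x\<bar> * indicator {y. N < \<bar>y\<bar>} x)" by simp
      also have "\<dots> \<le> 2 * C * (\<epsilon> / (4 * C + 4))" using N(3)[OF \<mu>] C by (intro mult_left_mono) auto
      also have "\<dots> < \<epsilon>"
      proof -
        have "0 \<le> C * (\<epsilon> * 2)" using C \<epsilon> by simp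
        then show ?thesis using C \<epsilon> by (simp add: field_simps add_pos_nonneg)
      qed
      finally show ?thesis .
    qed
    have "\<forall>\<^sub>F n in sequentially. N \<le> real n"
      using filterlim_real_sequentially by (simp add: filterlim_at_top)
    then show "\<forall>\<^sub>F n in sequentially. \<forall>\<mu>\<in>topspace (subtopology weak_topology \<Theta>).
        (LINT x|\<mu>. f x) \<in> UNIV \<and> dist (LINT x|\<mu>. clip n x) (LINT x|\<mu>. f x) < \<epsilon>"
      by eventually_elim (auto simp: dist_real_def close)
  qed simp
  then show ?thesis by simp
qed

text \<open>A continuous image of the compact \<open>\<Theta>\<close>; it supplies the compactness
  that Danskin's argument asks for.\<close>

lemma compact_integral_pairs:
  fixes f g :: "real \<Rightarrow> real"
  assumes "continuous_on UNIV f" "\<And>x. \<bar>f x\<bar> \<le> B * (1 + \<bar>x\<bar>)"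
    and "continuous_on UNIV g" "\<And>x. \<bar>g x\<bar> \<le> C * (1 + \<bar>x\<bar>)"
  shows "compact ((\<lambda>\<mu>. (LINT x|\<mu>. f x, LINT x|\<mu>. g x)) ` \<Theta>)"
proof -
  have "continuous_map (subtopology weak_topology \<Theta>) (prod_topology euclideanreal euclideanreal)
      (\<lambda>\<mu>. (LINT x|\<mu>. f x, LINT x|\<mu>. g x))"
    by (intro continuous_map_pairedI continuous_map_integral_linear_growth[OF assms(1,2)]
        continuous_map_integral_linear_growth[OF assms(3,4)])
  moreover have "compactin (subtopology weak_topology \<Theta>) \<Theta>"
    using cpt by (simp add: compactin_subtopology)
  ultimately have "compactin (prod_topology euclideanreal euclideanreal)
      ((\<lambda>\<mu>. (LINT x|\<mu>. f x, LINT x|\<mu>. g x)) ` \<Theta>)"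
    by (intro image_compactin)
  then show ?thesis by simp
qed

text \<open>Differentiation under the integral with an error uniform over \<open>\<Theta>\<close>:
  for \<open>\<bar>x\<bar> \<le> N\<close> the error is governed by uniform continuity of
  \<open>wd\<close>, beyond by linear growth and small tails. Increments are measured from the fixed
  \<open>s\<close>, so \<open>C\<close> may depend on \<open>s\<close>.\<close>

lemma uniform_integral_derivative:
  fixes w wd :: "real \<Rightarrow> real \<Rightarrow> real"
  assumes s: "s \<in> {p<..<q}"
    and w: "\<And>r. r \<in> {p<..<q} \<Longrightarrow> continuous_on UNIV (w r)"
      "\<And>r x. r \<in> {p<..<q} \<Longrightarrow> \<bar>w r x\<bar> \<le> B * (1 + \<bar>x\<bar>)"
    and deriv: "\<And>r x. r \<in> {p<..<q} \<Longrightarrow> ((\<lambda>r. w r x) has_real_derivative wd r x) (at r)"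
    and cont: "continuous_on ({p<..<q} \<times> UNIV) (\<lambda>(r, x). wd r x)"
    and growth: "\<And>r x. r \<in> {p<..<q} \<Longrightarrow> \<bar>w r x - w s x\<bar> \<le> C * (1 + \<bar>x\<bar>) * \<bar>r - s\<bar>"
  shows "continuous_on UNIV (wd s)" and "\<bar>wd s x\<bar> \<le> C * (1 + \<bar>x\<bar>)"
    and "0 < \<epsilon> \<Longrightarrow> \<forall>\<^sub>F h in at 0. \<forall>\<mu>\<in>\<Theta>.
      \<bar>(LINT x|\<mu>. w (s + h) x) - (LINT x|\<mu>. w s x) - h * (LINT x|\<mu>. wd s x)\<bar> \<le> \<epsilon> * \<bar>h\<bar>"
proof -
  have "continuous_on UNIV (\<lambda>x. (\<lambda>(r, x). wd r x) (s, x))"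
    by (rule continuous_on_compose2[OF cont]) (use s in \<open>auto intro!: continuous_intros\<close>)
  then show cont_s: "continuous_on UNIV (wd s)" by simp
  have near: "\<forall>\<^sub>F h in at 0. s + h \<in> {p<..<q}"
  proof -
    have "((\<lambda>h. s + h) \<longlongrightarrow> s + 0) (at 0)" by (intro tendsto_intros)
    then show ?thesis using s by (intro topological_tendstoD) auto
  qed
  show wd_le: "\<bar>wd s x\<bar> \<le> C * (1 + \<bar>x\<bar>)" for x
  proof -
    have "((\<lambda>h. (w (s + h) x - w s x) / h) \<longlongrightarrow> wd s x) (at 0)"
      using deriv[OF s, of x] by (simp add: DERIV_def)
    then have "((\<lambda>h. \<bar>(w (s + h) x - w s x) / h\<bar>) \<longlongrightarrow> \<bar>wd s x\<bar>) (at 0)" by (rule tendsto_rabs)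
    moreover have "\<forall>\<^sub>F h in at 0. \<bar>(w (s + h) x - w s x) / h\<bar> \<le> C * (1 + \<bar>x\<bar>)"
      using near eventually_neq_at_within[of 0]
    proof eventually_elim
      case (elim h)
      then show ?case using growth[of "s + h" x] by (simp add: field_simps)
    qed
    ultimately show ?thesis by (rule tendsto_upperbound) simp
  qed
  have C: "0 \<le> C" using wd_le[of 0] by simp
  assume \<epsilon>: "0 < \<epsilon>"
  \<comment> \<open>The tail will enter with the factor \<open>4 * C\<close> and so contributes at
    most \<open>\<epsilon> / 2\<close>; the region \<open>\<bar>x\<bar> \<le> N\<close> takes the
    other half.\<close>
  then have \<epsilon>': "0 < \<epsilon> / (8 * C + 8)" using C by simp
  obtain N where N: "1 \<le> N"
    "\<And>\<mu>. \<mu> \<in> \<Theta> \<Longrightarrow> integrable \<mu> (\<lambda>x. \<bar>x\<bar> * indicator {y. N < \<bar>y\<bar>} x)"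
    "\<And>\<mu>. \<mu> \<in> \<Theta> \<Longrightarrow> (LINT x|\<mu>. \<bar>x\<bar> * indicator {y. N < \<bar>y\<bar>} x) \<le> \<epsilon> / (8 * C + 8)"
    by (rule tail[OF \<epsilon>']) (rule that; blast)
  define \<delta>1 where "\<delta>1 = min (s - p) (q - s) / 2"
  have \<delta>1: "0 < \<delta>1" "p < s - \<delta>1" "s + \<delta>1 < q" using s by (auto simp: \<delta>1_def min_def field_simps)
  define K where "K = {s - \<delta>1..s + \<delta>1} \<times> {-N..N}"
  have "uniformly_continuous_on K (\<lambda>(r, x). wd r x)"
    unfolding K_def
    by (intro compact_uniformly_continuous compact_Times compact_Icc continuous_on_subset[OF cont])
      (use \<delta>1 in auto)
  then obtain \<delta>2 where \<delta>2: "0 < \<delta>2"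
    "\<And>z z'. z \<in> K \<Longrightarrow> z' \<in> K \<Longrightarrow> dist z' z < \<delta>2 \<Longrightarrow>
        dist ((\<lambda>(r, x). wd r x) z') ((\<lambda>(r, x). wd r x) z) < \<epsilon> / 2"
    using \<epsilon> unfolding uniformly_continuous_on_def by (metis half_gt_zero)
  define \<delta> where "\<delta> = min \<delta>1 \<delta>2"
  have \<delta>: "0 < \<delta>" using \<delta>1 \<delta>2 by (simp add: \<delta>_def)
  have osc: "\<bar>wd r x - wd s x\<bar> \<le> \<epsilon> / 2" if "\<bar>r - s\<bar> < \<delta>" "\<bar>x\<bar> \<le> N" for r x
    using \<delta>2(2)[of "(s, x)" "(r, x)"] that \<delta>1
    by (auto simp: K_def \<delta>_def dist_Pair_Pair dist_real_def abs_less_iff abs_le_iff)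
  have main: "\<bar>(LINT x|\<mu>. w (s + h) x) - (LINT x|\<mu>. w s x) - h * (LINT x|\<mu>. wd s x)\<bar> \<le> \<epsilon> * \<bar>h\<bar>"
    if h: "\<bar>h\<bar> < \<delta>" and \<mu>: "\<mu> \<in> \<Theta>" for h \<mu>
  proof -
    interpret prob_space \<mu> using prob_space[OF \<mu>] .
    have sh: "s + h \<in> {p<..<q}" using h \<delta>1 by (auto simp: \<delta>_def abs_less_iff)
    define d where "d x = w (s + h) x - w s x - h * wd s x" for x
    have pt: "\<bar>d x\<bar> \<le> \<bar>h\<bar> * (\<epsilon> / 2 + 4 * C * (\<bar>x\<bar> * indicator {y. N < \<bar>y\<bar>} x))" for x
    proof (cases "N < \<bar>x\<bar>")
      case True
      have "\<bar>d x\<bar> \<le> \<bar>w (s + h) x - w s x\<bar> + \<bar>h\<bar> * \<bar>wd s x\<bar>"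
        unfolding d_def by (metis abs_mult abs_triangle_ineq4)
      also have "\<dots> \<le> C * (1 + \<bar>x\<bar>) * \<bar>h\<bar> + \<bar>h\<bar> * (C * (1 + \<bar>x\<bar>))"
        using growth[OF sh, of x] wd_le[of x] by (intro add_mono mult_left_mono) auto
      also have "\<dots> = \<bar>h\<bar> * (2 * C * (1 + \<bar>x\<bar>))" by (simp add: algebra_simps)
      also have "\<dots> \<le> \<bar>h\<bar> * (2 * C * (2 * \<bar>x\<bar>))"
        using True N(1) C by (intro mult_left_mono) auto
      also have "\<dots> \<le> \<bar>h\<bar> * (\<epsilon> / 2 + 4 * C * \<bar>x\<bar>)" using \<epsilon> by (intro mult_left_mono) auto
      finally show ?thesis using True by simp
    next
      case False
      \<comment> \<open>With the linear part at \<open>s\<close> subtracted, the derivative of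
        \<open>k\<close> is the oscillation of \<open>wd\<close>, and the mean value inequality
        applies.\<close>
      define k where "k r = w r x - r * wd s x" for r
      have "norm (k (s + h) - k s) \<le> \<epsilon> / 2 * norm (s + h - s)"
      proof (rule field_differentiable_bound[of "{s - \<bar>h\<bar>..s + \<bar>h\<bar>}"])
        fix r assume r: "r \<in> {s - \<bar>h\<bar>..s + \<bar>h\<bar>}"
        then have r': "\<bar>r - s\<bar> < \<delta>" "r \<in> {p<..<q}"
          using h \<delta>1 by (auto simp: \<delta>_def abs_less_iff)
        show "(k has_field_derivative (wd r x - wd s x)) (at r within {s - \<bar>h\<bar>..s + \<bar>h\<bar>})"
          unfolding k_def[abs_def]
          by (rule derivative_eq_intros DERIV_subset[OF deriv[OF r'(2)]] refl subset_UNIV | simp)+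
        show "norm (wd r x - wd s x) \<le> \<epsilon> / 2" using osc[OF r'(1), of x] False by simp
      qed auto
      then show ?thesis using False by (simp add: k_def d_def algebra_simps)
    qed
    have iw: "integrable \<mu> (w (s + h))" "integrable \<mu> (w s)"
      by (auto intro!: integrable_linear_growth[OF \<mu> w(1) w(2)] sh s)
    have iwd: "integrable \<mu> (wd s)" by (rule integrable_linear_growth[OF \<mu> cont_s wd_le])
    have id: "integrable \<mu> d" unfolding d_def[abs_def] using iw iwd by simp
    have it: "integrable \<mu> (\<lambda>x. \<epsilon> / 2 + 4 * C * (\<bar>x\<bar> * indicator {y. N < \<bar>y\<bar>} x))"
      by (intro Bochner_Integration.integrable_add integrable_const integrable_mult_right N(2) \<mu>)
    have "(LINT x|\<mu>. w (s + h) x) - (LINT x|\<mu>. w s x) - h * (LINT x|\<mu>. wd s x) = (LINT x|\<mu>. d x)"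
      unfolding d_def using iw iwd by simp
    also have "\<bar>LINT x|\<mu>. d x\<bar> \<le> (LINT x|\<mu>. \<bar>d x\<bar>)" by (rule integral_abs_bound)
    also have "\<dots> \<le> (LINT x|\<mu>. \<bar>h\<bar> * (\<epsilon> / 2 + 4 * C * (\<bar>x\<bar> * indicator {y. N < \<bar>y\<bar>} x)))"
      by (intro integral_mono integrable_mult_right it pt Bochner_Integration.integrable_abs id)
    also have "\<dots> = \<bar>h\<bar> * (\<epsilon> / 2 + 4 * C * (LINT x|\<mu>. \<bar>x\<bar> * indicator {y. N < \<bar>y\<bar>} x))"
    proof -
      have "(LINT x|\<mu>. \<epsilon> / 2 + 4 * C * (\<bar>x\<bar> * indicator {y. N < \<bar>y\<bar>} x))
          = (LINT x|\<mu>. \<epsilon> / 2) + (LINT x|\<mu>. 4 * C * (\<bar>x\<bar> * indicator {y. N < \<bar>y\<bar>} x))"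
        by (intro Bochner_Integration.integral_add integrable_const integrable_mult_right N(2) \<mu>)
      then show ?thesis by (simp add: prob_space)
    qed
    also have "\<dots> \<le> \<bar>h\<bar> * (\<epsilon> / 2 + 4 * C * (\<epsilon> / (8 * C + 8)))"
      using N(3)[OF \<mu>] C by (intro mult_left_mono add_left_mono) auto
    also have "\<dots> \<le> \<bar>h\<bar> * \<epsilon>"
      using C \<epsilon> by (intro mult_left_mono) (auto simp: field_simps)
    finally show ?thesis by (simp add: mult.commute)
  qed
  show "\<forall>\<^sub>F h in at 0. \<forall>\<mu>\<in>\<Theta>.
      \<bar>(LINT x|\<mu>. w (s + h) x) - (LINT x|\<mu>. w s x) - h * (LINT x|\<mu>. wd s x)\<bar> \<le> \<epsilon> * \<bar>h\<bar>"
    unfolding eventually_at using \<delta> main by (intro exI[of _ \<delta>]) (auto simp: dist_real_def)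
qed

end

section \<open>Elementary facts on suprema and square roots\<close>

lemma abs_SUP_diff_le:
  fixes f g :: "'i \<Rightarrow> real"
  assumes "I \<noteq> {}" "bdd_above (f ` I)" "bdd_above (g ` I)"
    and le: "\<And>i. i \<in> I \<Longrightarrow> \<bar>f i - g i\<bar> \<le> c"
  shows "\<bar>(SUP i\<in>I. f i) - (SUP i\<in>I. g i)\<bar> \<le> c"
proof -
  have "(SUP i\<in>I. f i) \<le> (SUP i\<in>I. g i) + c"
  proof (rule cSUP_least[OF assms(1)])
    fix i assume "i \<in> I"
    then show "f i \<le> (SUP i\<in>I. g i) + c" using le[of i] cSUP_upper[OF _ assms(3), of i] by linarith
  qed
  moreover have "(SUP i\<in>I. g i) \<le> (SUP i\<in>I. f i) + c"
  proof (rule cSUP_least[OF assms(1)])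
    fix i assume "i \<in> I"
    then show "g i \<le> (SUP i\<in>I. f i) + c" using le[of i] cSUP_upper[OF _ assms(2), of i] by linarith
  qed
  ultimately show ?thesis by linarith
qed

lemma
  fixes f :: "'i \<Rightarrow> real"
  assumes "0 \<le> c" "bounded (f ` I)" "I \<noteq> {}"
  shows real_SUP_cmult: "(SUP i\<in>I. c * f i) = c * (SUP i\<in>I. f i)"
    and real_INF_cmult: "(INF i\<in>I. c * f i) = c * (INF i\<in>I. f i)"
proof -
  have m: "mono ((*) c)" using assms(1) by (auto intro: monoI mult_left_mono)
  have bdd: "bdd_above (f ` I)" "bdd_below (f ` I)"
    using assms(2) by (auto intro: bounded_imp_bdd_above bounded_imp_bdd_below)
  show "(SUP i\<in>I. c * f i) = c * (SUP i\<in>I. f i)"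
    using continuous_at_Sup_mono[OF m _ _ bdd(1)] assms(3)
    by (simp add: image_image continuous_intros)
  show "(INF i\<in>I. c * f i) = c * (INF i\<in>I. f i)"
    using continuous_at_Inf_mono[OF m _ _ bdd(2)] assms(3)
    by (simp add: image_image continuous_intros)
qed

text \<open>In \<open>(sqrt r - sqrt s) * (sqrt r + sqrt s) = r - s\<close> the second factor is at
  least \<open>sqrt s\<close>. The resulting constant depends on the base point \<open>s\<close>
  alone, so \<open>r\<close> may approach 0.\<close>

lemma abs_sqrt_diff_le:
  assumes "0 < s" "0 \<le> r"
  shows "\<bar>sqrt r - sqrt s\<bar> \<le> \<bar>r - s\<bar> / sqrt s"
proof -
  have "\<bar>r - s\<bar> = \<bar>(sqrt r - sqrt s) * (sqrt r + sqrt s)\<bar>"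
    using assms by (simp add: algebra_simps)
  also have "\<dots> = \<bar>sqrt r - sqrt s\<bar> * (sqrt r + sqrt s)"
    using assms by (simp add: abs_mult)
  finally have "\<bar>sqrt r - sqrt s\<bar> * sqrt s \<le> \<bar>r - s\<bar>"
    using assms by (simp add: distrib_left)
  then show ?thesis using assms by (simp add: field_simps)
qed

section \<open>One-sided derivatives of the upper expectation\<close>

context weakly_compact_UI
begin

text \<open>Danskin's argument with \<open>a\<close> and \<open>l\<close> the integrals of
  \<open>w s\<close> and \<open>wd s\<close>. The left derivative comes from reversing the
  parameter, which replaces \<open>l\<close> by \<open>- l\<close>, and the supremum of
  \<open>- l\<close> is minus the infimum of \<open>l\<close>.\<close>

lemma upper_exp_derivative:
  fixes w wd :: "real \<Rightarrow> real \<Rightarrow> real"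
  assumes s: "s \<in> {p<..<q}"
    and w: "\<And>r. r \<in> {p<..<q} \<Longrightarrow> continuous_on UNIV (w r)"
      "\<And>r x. r \<in> {p<..<q} \<Longrightarrow> \<bar>w r x\<bar> \<le> B * (1 + \<bar>x\<bar>)"
    and deriv: "\<And>r x. r \<in> {p<..<q} \<Longrightarrow> ((\<lambda>r. w r x) has_real_derivative wd r x) (at r)"
    and cont: "continuous_on ({p<..<q} \<times> UNIV) (\<lambda>(r, x). wd r x)"
    and growth: "\<And>r x. r \<in> {p<..<q} \<Longrightarrow> \<bar>w r x - w s x\<bar> \<le> C * (1 + \<bar>x\<bar>) * \<bar>r - s\<bar>"
  defines "F \<equiv> \<lambda>r. upper_exp \<Theta> (w r)" and "M \<equiv> maximizers \<Theta> (w s)"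
  shows "M \<noteq> {}" and "bounded ((\<lambda>\<mu>. LINT x|\<mu>. wd s x) ` M)"
    and "\<mu> \<in> M \<Longrightarrow> integrable \<mu> (wd s)"
    and "((\<lambda>h. (F (s + h) - F s) / h) \<longlongrightarrow> (SUP \<mu>\<in>M. LINT x|\<mu>. wd s x)) (at_right 0)"
    and "((\<lambda>h. (F (s + h) - F s) / h) \<longlongrightarrow> (INF \<mu>\<in>M. LINT x|\<mu>. wd s x)) (at_left 0)"
proof -
  have ud1: "continuous_on UNIV (wd s)"
    by (rule uniform_integral_derivative(1)[OF s w deriv cont growth])
  have ud2: "\<bar>wd s x\<bar> \<le> C * (1 + \<bar>x\<bar>)" for x
    by (rule uniform_integral_derivative(2)[OF s w deriv cont growth])
  have ud3: "\<forall>\<^sub>F h in at 0. \<forall>\<mu>\<in>\<Theta>.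
      \<bar>(LINT x|\<mu>. w (s + h) x) - (LINT x|\<mu>. w s x) - h * (LINT x|\<mu>. wd s x)\<bar> \<le> \<epsilon> * \<bar>h\<bar>" if "0 < \<epsilon>" for \<epsilon>
    by (rule uniform_integral_derivative(3)[OF s w deriv cont growth that])
  define a where "a \<mu> = (LINT x|\<mu>. w s x)" for \<mu>
  define l where "l \<mu> = (LINT x|\<mu>. wd s x)" for \<mu>
  have M: "M = {\<mu> \<in> \<Theta>. a \<mu> = (SUP \<mu>\<in>\<Theta>. a \<mu>)}"
    by (simp add: M_def maximizers_def upper_exp_def a_def)
  have cpt: "compact ((\<lambda>\<mu>. (a \<mu>, l \<mu>)) ` \<Theta>)"
    unfolding a_def l_def by (intro compact_integral_pairs[where B = B and C = C] w s ud1 ud2)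
  have cpt': "compact ((\<lambda>\<mu>. (a \<mu>, - l \<mu>)) ` \<Theta>)"
  proof -
    have "compact ((\<lambda>(x, y). (x, - y)) ` (\<lambda>\<mu>. (a \<mu>, l \<mu>)) ` \<Theta>)"
      by (intro compact_continuous_image cpt) (auto simp: case_prod_unfold intro!: continuous_intros)
    then show ?thesis by (simp add: image_image)
  qed
  have ev: "\<forall>\<^sub>F h in at_right 0. \<forall>\<mu>\<in>\<Theta>. \<bar>(LINT x|\<mu>. w (s + h) x) - a \<mu> - h * l \<mu>\<bar> \<le> \<epsilon> * h" if "0 < \<epsilon>" for \<epsilon>
  proof -
    have "\<forall>\<^sub>F h in at_right 0. \<forall>\<mu>\<in>\<Theta>. \<bar>(LINT x|\<mu>. w (s + h) x) - a \<mu> - h * l \<mu>\<bar> \<le> \<epsilon> * \<bar>h\<bar>"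
      using ud3[OF that] unfolding a_def l_def by (rule filter_leD[OF at_le[OF subset_UNIV]])
    then show ?thesis using eventually_at_right_less by eventually_elim simp
  qed
  have ev': "\<forall>\<^sub>F h in at_right 0. \<forall>\<mu>\<in>\<Theta>. \<bar>(LINT x|\<mu>. w (s - h) x) - a \<mu> - h * - l \<mu>\<bar> \<le> \<epsilon> * h" if "0 < \<epsilon>" for \<epsilon>
  proof -
    have "\<forall>\<^sub>F h in at_left 0. \<forall>\<mu>\<in>\<Theta>. \<bar>(LINT x|\<mu>. w (s + h) x) - a \<mu> - h * l \<mu>\<bar> \<le> \<epsilon> * \<bar>h\<bar>"
      using ud3[OF that] unfolding a_def l_def by (rule filter_leD[OF at_le[OF subset_UNIV]])
    then have "\<forall>\<^sub>F h in at_right 0. \<forall>\<mu>\<in>\<Theta>. \<bar>(LINT x|\<mu>. w (s - h) x) - a \<mu> - h * - l \<mu>\<bar> \<le> \<epsilon> * \<bar>h\<bar>"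
      by (simp add: at_left_minus eventually_filtermap)
    then show ?thesis using eventually_at_right_less by eventually_elim simp
  qed
  have R: "M \<noteq> {}" "bounded (l ` \<Theta>)"
    "((\<lambda>h. ((SUP \<mu>\<in>\<Theta>. LINT x|\<mu>. w (s + h) x) - (SUP \<mu>\<in>\<Theta>. a \<mu>)) / h) \<longlongrightarrow> (SUP \<mu>\<in>M. l \<mu>)) (at_right 0)"
    unfolding M by (rule parametric_sup_derivative[OF nonempty cpt ev]; assumption)+
  have Lf: "((\<lambda>h. ((SUP \<mu>\<in>\<Theta>. LINT x|\<mu>. w (s - h) x) - (SUP \<mu>\<in>\<Theta>. a \<mu>)) / h) \<longlongrightarrow> (SUP \<mu>\<in>M. - l \<mu>)) (at_right 0)"
    unfolding M by (rule parametric_sup_derivative(3)[OF nonempty cpt' ev'])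
  show "M \<noteq> {}" by (rule R(1))
  have "l ` M \<subseteq> l ` \<Theta>" by (auto simp: M)
  with R(2) show "bounded ((\<lambda>\<mu>. LINT x|\<mu>. wd s x) ` M)"
    unfolding l_def by (rule bounded_subset)
  show "integrable \<mu> (wd s)" if "\<mu> \<in> M"
    using that by (intro integrable_linear_growth[OF _ ud1 ud2]) (auto simp: M)
  show "((\<lambda>h. (F (s + h) - F s) / h) \<longlongrightarrow> (SUP \<mu>\<in>M. LINT x|\<mu>. wd s x)) (at_right 0)"
    using R(3) by (simp add: F_def upper_exp_def a_def l_def)
  have "(SUP \<mu>\<in>M. - l \<mu>) = - (INF \<mu>\<in>M. l \<mu>)"
    by (simp add: Inf_real_def image_image)
  with Lf have "((\<lambda>h. - ((F (s - h) - F s) / h)) \<longlongrightarrow> - (- (INF \<mu>\<in>M. l \<mu>))) (at_right 0)"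
    by (intro tendsto_minus) (simp add: F_def upper_exp_def a_def)
  then show "((\<lambda>h. (F (s + h) - F s) / h) \<longlongrightarrow> (INF \<mu>\<in>M. LINT x|\<mu>. wd s x)) (at_left 0)"
    by (simp add: at_left_minus filterlim_filtermap l_def)
qed

end

section \<open>The interpolation\<close>

text \<open>The parameter moves both arguments of \<open>v\<close>. The heat equation turns the time
  derivative into \<open>G\<close> of the second space derivative, and homogeneity of
  \<open>G\<close> produces the factor \<open>1 / (1 - s)\<close>. The second form involves only
  first derivatives of \<open>v\<close>, which is convenient for joint continuity.\<close>

lemma interp_derivatives:
  assumes v: "G_heat_solution \<sigma>low \<sigma>up \<phi> v" and s: "s \<in> {0<..<1}"
  shows "((\<lambda>s. interp v s x) has_real_derivative L_G \<sigma>low \<sigma>up (interp v s) x / (1 - s)) (at s)" (is ?D)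
    and "L_G \<sigma>low \<sigma>up (interp v s) x / (1 - s) = deriv (\<lambda>\<tau>. v (sqrt (1 - s) * x) \<tau>) s
      - x / (2 * sqrt (1 - s)) * deriv (\<lambda>y. v y s) (sqrt (1 - s) * x)" (is ?E)
proof -
  define c where "c = sqrt (1 - s)"
  have c: "0 < c" "c * c = 1 - s" using s by (auto simp: c_def)
  have s0: "0 < s" using s by simp
  have lin: "((\<lambda>y. c * y) has_real_derivative c) (at y)" for y by (auto intro!: derivative_eq_intros)
  have d1: "deriv (interp v s) = (\<lambda>y. c * deriv (\<lambda>y. v y s) (c * y))"
    using DERIV_chain2[OF G_heat_solution_derivs(1)[OF v s0] lin]
    by (auto simp: interp_def[abs_def] c_def mult.commute intro!: DERIV_imp_deriv)
  have d2: "deriv (deriv (interp v s)) x = c * c * deriv (deriv (\<lambda>y. v y s)) (c * x)"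
    unfolding d1
    using DERIV_cmult[OF DERIV_chain2[OF G_heat_solution_derivs(2)[OF v s0] lin], of c x]
    by (intro DERIV_imp_deriv) (simp add: mult_ac)
  have "L_G \<sigma>low \<sigma>up (interp v s) x =
      c * c * deriv (\<lambda>\<tau>. v (c * x) \<tau>) s - x / 2 * (c * deriv (\<lambda>y. v y s) (c * x))"
    unfolding L_G_def d2 fun_cong[OF d1] G_heat_solution_derivs(4)[OF v s0]
    using G_fun_mult[of "c * c" \<sigma>low \<sigma>up] c(1) by simp
  then have "L_G \<sigma>low \<sigma>up (interp v s) x / (c * c) =
      deriv (\<lambda>\<tau>. v (c * x) \<tau>) s - x / (2 * c) * deriv (\<lambda>y. v y s) (c * x)"
    using c(1) by (simp add: field_simps)
  then show E: ?E by (simp add: c(2) flip: c_def)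
  have C21: "C21 v" using v by (simp add: G_heat_solution_def)
  \<comment> \<open>Joint differentiability follows from the two partial derivatives because the one
    in time is jointly continuous; it is written as a bounded linear map so that this continuity can
    be expressed.\<close>
  have "((\<lambda>(y, t). v y t) has_derivative
      (\<lambda>(ty, tt). ty * deriv (\<lambda>y. v y s) (c * x) + blinfun_mult_left (deriv (\<lambda>\<tau>. v (c * x) \<tau>) s) tt))
      (at (c * x, s) within UNIV \<times> {0<..})"
  proof (rule has_derivative_partialsI[where fy = "\<lambda>y t. blinfun_mult_left (deriv (\<lambda>\<tau>. v y \<tau>) t)"])
    show "((\<lambda>y. v y s) has_derivative (\<lambda>ty. ty * deriv (\<lambda>y. v y s) (c * x))) (at (c * x))"
      using G_heat_solution_derivs(1)[OF v s0] unfolding has_field_derivative_def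
      by (rule has_derivative_eq_rhs) (auto simp: mult.commute)
    show "((\<lambda>t. v y t) has_derivative blinfun_mult_left (deriv (\<lambda>\<tau>. v y \<tau>) t)) (at t within {0<..})"
      if "t \<in> {0<..}" for y t
    proof -
      have "(v y has_derivative (*) (deriv (v y) t)) (at t within {0<..})"
        using G_heat_solution_derivs(3)[OF v, of t y] that
        by (auto simp: has_field_derivative_def intro: has_derivative_at_withinI)
      moreover have "(*) (deriv (v y) t) = blinfun_apply (blinfun_mult_left (deriv (v y) t))"
        by (auto simp: mult.commute)
      ultimately show ?thesis by simp
    qed
    have "continuous_on (UNIV \<times> {0<..}) (\<lambda>(x, t). blinfun_mult_left (deriv (\<lambda>\<tau>. v x \<tau>) t))"
      using C21 unfolding C21_def case_prod_unfold
      by (intro bounded_linear.continuous_on[OF bounded_linear_blinfun_mult_left]) auto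
    then show "continuous (at (c * x, s) within UNIV \<times> {0<..})
        (\<lambda>(x, t). blinfun_mult_left (deriv (\<lambda>\<tau>. v x \<tau>) t))"
      using s0 by (simp add: continuous_on_eq_continuous_within)
  qed (use s0 in auto)
  then have tot: "((\<lambda>(y, t). v y t) has_derivative
      (\<lambda>(ty, tt). ty * deriv (\<lambda>y. v y s) (c * x) + tt * deriv (\<lambda>\<tau>. v (c * x) \<tau>) s)) (at (c * x, s))"
    by (subst (asm) at_within_open)
      (use s0 in \<open>auto simp: case_prod_unfold intro!: open_Times\<close>)
  have cx: "((\<lambda>r. sqrt (1 - r) * x) has_real_derivative - (x / (2 * c))) (at s)"
    using s unfolding c_def
    by (auto intro!: derivative_eq_intros simp: field_simps)
  have "((\<lambda>r. (sqrt (1 - r) * x, r)) has_derivative (\<lambda>h. (- (x / (2 * c)) * h, h))) (at s)"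
    using cx unfolding has_field_derivative_def by (intro has_derivative_Pair has_derivative_ident)
  from has_derivative_compose[OF this] tot
  have "((\<lambda>r. v (sqrt (1 - r) * x) r) has_derivative
      (\<lambda>h. - (x / (2 * c)) * h * deriv (\<lambda>y. v y s) (c * x) + h * deriv (\<lambda>\<tau>. v (c * x) \<tau>) s)) (at s)"
    unfolding c_def by (force simp: case_prod_unfold)
  then show ?D
    unfolding E interp_def has_field_derivative_def
    by (rule has_derivative_eq_rhs) (auto simp: c_def algebra_simps)
qed

lemma interp_derivative_continuous:
  assumes v: "G_heat_solution \<sigma>low \<sigma>up \<phi> v"
  shows "continuous_on ({0<..<1} \<times> UNIV) (\<lambda>(s, x). L_G \<sigma>low \<sigma>up (interp v s) x / (1 - s))"
proof -
  have C21: "C21 v" using v by (simp add: G_heat_solution_def)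
  let ?Z = "{0<..<1::real} \<times> (UNIV :: real set)"
  have scale: "continuous_on ?Z (\<lambda>z. (sqrt (1 - fst z) * snd z, fst z))"
    by (intro continuous_intros)
  have into: "(\<lambda>z. (sqrt (1 - fst z) * snd z, fst z)) ` ?Z \<subseteq> UNIV \<times> {0<..}" by auto
  have "continuous_on ?Z (\<lambda>z. (\<lambda>(x, t). deriv (\<lambda>\<tau>. v x \<tau>) t) (sqrt (1 - fst z) * snd z, fst z))"
    "continuous_on ?Z (\<lambda>z. (\<lambda>(x, t). deriv (\<lambda>y. v y t) x) (sqrt (1 - fst z) * snd z, fst z))"
    using C21 unfolding C21_def by (blast intro: continuous_on_compose2[OF _ scale into])+
  then have "continuous_on ?Z (\<lambda>z. deriv (\<lambda>\<tau>. v (sqrt (1 - fst z) * snd z) \<tau>) (fst z)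
      - snd z / (2 * sqrt (1 - fst z)) * deriv (\<lambda>y. v y (fst z)) (sqrt (1 - fst z) * snd z))"
    by (intro continuous_intros) auto
  then show ?thesis
    by (rule continuous_on_eq) (auto simp: interp_derivatives(2)[OF v])
qed

text \<open>First the space argument is moved at the fixed time \<open>r\<close>, then the time.
  Measured by differences of square roots, the bound remains finite and continuous up to both
  endpoints.\<close>

lemma interp_diff_le:
  assumes \<sigma>: "0 \<le> \<sigma>low" "\<sigma>low \<le> \<sigma>up" "0 < \<sigma>up" and v: "G_heat_solution \<sigma>low \<sigma>up \<phi> v"
    and L: "L-lipschitz_on UNIV \<phi>" and s: "s \<in> {0..1}" "r \<in> {0..1}"
  shows "\<bar>interp v r x - interp v s x\<bar>
    \<le> L * \<sigma>up * \<bar>sqrt r - sqrt s\<bar> + L * \<bar>x\<bar> * \<bar>sqrt (1 - r) - sqrt (1 - s)\<bar>"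
proof -
  have "\<bar>v (sqrt (1 - r) * x) r - v (sqrt (1 - s) * x) r\<bar> \<le> L * \<bar>sqrt (1 - r) * x - sqrt (1 - s) * x\<bar>"
    using s by (intro G_heat_solution_lipschitz[OF \<sigma>(1,2) v L]) auto
  also have "\<dots> = L * \<bar>x\<bar> * \<bar>sqrt (1 - r) - sqrt (1 - s)\<bar>"
    by (simp add: abs_mult[symmetric] algebra_simps)
  finally have 1: "\<bar>v (sqrt (1 - r) * x) r - v (sqrt (1 - s) * x) r\<bar>
    \<le> L * \<bar>x\<bar> * \<bar>sqrt (1 - r) - sqrt (1 - s)\<bar>" .
  have "\<bar>v (sqrt (1 - s) * x) r - v (sqrt (1 - s) * x) s\<bar> \<le> L * \<sigma>up * \<bar>sqrt r - sqrt s\<bar>"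
    using s by (intro G_heat_solution_time_regularity[OF \<sigma> v L]) auto
  with 1 show ?thesis unfolding interp_def by linarith
qed

text \<open>Real suprema, infima and Bochner integrals always have some value, even a meaningless
  one. The conclusions on nonempty maximizers, boundedness and integrability certify that the values
  in the identities are the genuine ones.\<close>

theorem lemma4p1:
  fixes \<sigma>low \<sigma>up :: real
    and \<Theta> :: "real measure set"
    and \<phi> :: "real \<Rightarrow> real"
    and v :: "real \<Rightarrow> real \<Rightarrow> real"
  assumes "0 < \<sigma>low" and "\<sigma>low \<le> \<sigma>up"
    and "\<Theta> \<noteq> {}" and "\<Theta> \<subseteq> borel_probs" and "compactin weak_topology \<Theta>"
    and "((\<lambda>N::real. nn_upper_exp \<Theta> (\<lambda>x. ennreal \<bar>x\<bar> * indicator {y. \<bar>y\<bar> > N} x)) \<longlongrightarrow> 0) at_top"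
    and "\<phi> \<in> Cb_Lip"
    and "G_heat_solution \<sigma>low \<sigma>up \<phi> v"
  shows
    "(\<forall>s\<in>{0<..<1}.
        maximizers \<Theta> (interp v s) \<noteq> {} \<and>
        (\<forall>\<mu>\<in>maximizers \<Theta> (interp v s). integrable \<mu> (L_G \<sigma>low \<sigma>up (interp v s))) \<and>
        bounded ((\<lambda>\<mu>. LINT x|\<mu>. L_G \<sigma>low \<sigma>up (interp v s) x) ` maximizers \<Theta> (interp v s)))
     \<and>
     set_integrable lborel {0<..<1}
       (\<lambda>s. 1 / (1 - s) * (SUP \<mu>\<in>maximizers \<Theta> (interp v s). LINT x|\<mu>. L_G \<sigma>low \<sigma>up (interp v s) x))
     \<and>
     set_integrable lborel {0<..<1}
       (\<lambda>s. 1 / (1 - s) * (INF \<mu>\<in>maximizers \<Theta> (interp v s). LINT x|\<mu>. L_G \<sigma>low \<sigma>up (interp v s) x))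
     \<and>
     G_normal \<sigma>low \<sigma>up \<phi> - upper_exp \<Theta> \<phi> =
       (LINT s:{0<..<1}|lborel.
          1 / (1 - s) * (SUP \<mu>\<in>maximizers \<Theta> (interp v s). LINT x|\<mu>. L_G \<sigma>low \<sigma>up (interp v s) x))
     \<and>
     G_normal \<sigma>low \<sigma>up \<phi> - upper_exp \<Theta> \<phi> =
       (LINT s:{0<..<1}|lborel.
          1 / (1 - s) * (INF \<mu>\<in>maximizers \<Theta> (interp v s). LINT x|\<mu>. L_G \<sigma>low \<sigma>up (interp v s) x))
     \<and>
     (AE s in lborel. s \<in> {0<..<1} \<longrightarrow>
       (SUP \<mu>\<in>maximizers \<Theta> (interp v s). LINT x|\<mu>. L_G \<sigma>low \<sigma>up (interp v s) x) =
       (INF \<mu>\<in>maximizers \<Theta> (interp v s). LINT x|\<mu>. L_G \<sigma>low \<sigma>up (interp v s) x))"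
proof -
  interpret weakly_compact_UI \<Theta> using assms by unfold_locales
  note v = assms(8)
  have \<sigma>: "0 \<le> \<sigma>low" "\<sigma>low \<le> \<sigma>up" "0 < \<sigma>up" using assms(1,2) by auto
  obtain L where L: "L-lipschitz_on UNIV \<phi>" using assms(7) by (auto simp: Cb_Lip_def)
  have L0: "0 \<le> L" using L by (rule lipschitz_on_nonneg)
  obtain B where B: "\<And>x t. 0 \<le> t \<Longrightarrow> \<bar>v x t\<bar> \<le> B" using v by (auto simp: G_heat_solution_def)
  obtain m where m: "0 \<le> m" "\<And>\<mu>. \<mu> \<in> \<Theta> \<Longrightarrow> (LINT x|\<mu>. \<bar>x\<bar>) \<le> m" by (rule moment_bound) (rule that; blast)
  let ?w = "interp v"
  define wd where "wd s x = L_G \<sigma>low \<sigma>up (?w s) x / (1 - s)" for s x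
  define M where "M s = maximizers \<Theta> (?w s)" for s
  define F where "F s = upper_exp \<Theta> (?w s)" for s
  have w_cont: "continuous_on UNIV (?w s)" if "0 \<le> s" for s
  proof -
    have "continuous_on (UNIV \<times> {0..}) (\<lambda>(x, t). v x t)" using v by (simp add: G_heat_solution_def)
    then have "continuous_on UNIV (\<lambda>x. (\<lambda>(x, t). v x t) (sqrt (1 - s) * x, s))"
      by (rule continuous_on_compose2) (use that in \<open>auto intro!: continuous_intros\<close>)
    then show ?thesis by (simp add: interp_def[abs_def])
  qed
  have w_bdd: "\<bar>?w s x\<bar> \<le> B" if "0 \<le> s" for s x using B[OF that] by (simp add: interp_def)
  have B0: "0 \<le> B" using w_bdd[of 0 0] by simp
  have w_growth: "\<bar>?w s x\<bar> \<le> B * (1 + \<bar>x\<bar>)" if "0 \<le> s" for s x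
  proof -
    have "0 \<le> B * \<bar>x\<bar>" using B0 by simp
    with w_bdd[OF that, of x] have "\<bar>?w s x\<bar> \<le> B + B * \<bar>x\<bar>" by linarith
    then show ?thesis by (simp add: distrib_left)
  qed
  have w_int: "integrable \<mu> (?w s)" if "\<mu> \<in> \<Theta>" "0 \<le> s" for \<mu> s
    by (rule integrable_linear_growth[OF that(1) w_cont[OF that(2)] w_growth[OF that(2)]])

  \<comment> \<open>One-sided derivatives of \<open>F\<close> at interior parameters\<close>
  have D: "M s \<noteq> {}" "bounded ((\<lambda>\<mu>. LINT x|\<mu>. wd s x) ` M s)" "\<And>\<mu>. \<mu> \<in> M s \<Longrightarrow> integrable \<mu> (wd s)"
    "((\<lambda>h. (F (s + h) - F s) / h) \<longlongrightarrow> (SUP \<mu>\<in>M s. LINT x|\<mu>. wd s x)) (at_right 0)"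
    "((\<lambda>h. (F (s + h) - F s) / h) \<longlongrightarrow> (INF \<mu>\<in>M s. LINT x|\<mu>. wd s x)) (at_left 0)"
    if s: "s \<in> {0<..<1}" for s
  proof -
    \<comment> \<open>The two terms come from \<open>abs_sqrt_diff_le\<close> at \<open>s\<close>
      and at \<open>1 - s\<close>. The constant blows up at the endpoints, which is harmless here
      because \<open>s\<close> is fixed.\<close>
    define C where "C = L * \<sigma>up / sqrt s + L / sqrt (1 - s)"
    have growth: "\<bar>?w r x - ?w s x\<bar> \<le> C * (1 + \<bar>x\<bar>) * \<bar>r - s\<bar>" if r: "r \<in> {0<..<1}" for r x
    proof -
      have "\<bar>?w r x - ?w s x\<bar> \<le> L * \<sigma>up * \<bar>sqrt r - sqrt s\<bar> + L * \<bar>x\<bar> * \<bar>sqrt (1 - r) - sqrt (1 - s)\<bar>"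
        using r s by (intro interp_diff_le[OF \<sigma> v L]) auto
      also have "\<dots> \<le> L * \<sigma>up * (\<bar>r - s\<bar> / sqrt s) + L * \<bar>x\<bar> * (\<bar>r - s\<bar> / sqrt (1 - s))"
        using abs_sqrt_diff_le[of s r] abs_sqrt_diff_le[of "1 - s" "1 - r"] r s L0 \<sigma>
        by (intro add_mono mult_left_mono) (auto simp: abs_minus_commute)
      also have "\<dots> = (L * \<sigma>up / sqrt s + L / sqrt (1 - s) * \<bar>x\<bar>) * \<bar>r - s\<bar>"
        by (simp add: field_simps)
      also have "\<dots> \<le> C * (1 + \<bar>x\<bar>) * \<bar>r - s\<bar>"
      proof (rule mult_right_mono)
        have "0 \<le> L * \<sigma>up / sqrt s * \<bar>x\<bar>" "0 \<le> L / sqrt (1 - s)" using L0 \<sigma> s by auto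
        then show "L * \<sigma>up / sqrt s + L / sqrt (1 - s) * \<bar>x\<bar> \<le> C * (1 + \<bar>x\<bar>)"
          unfolding C_def by (simp only: distrib_left distrib_right mult_1_right)
      qed simp
      finally show ?thesis .
    qed
    have deriv: "((\<lambda>r. ?w r x) has_real_derivative wd r x) (at r)" if "r \<in> {0<..<1}" for r x
      unfolding wd_def by (rule interp_derivatives(1)[OF v that])
    have cont: "continuous_on ({0<..<1} \<times> UNIV) (\<lambda>(r, x). wd r x)"
      unfolding wd_def by (rule interp_derivative_continuous[OF v])
    have wc: "continuous_on UNIV (?w r)" "\<bar>?w r x\<bar> \<le> B * (1 + \<bar>x\<bar>)" if "r \<in> {0<..<1}" for r x
      using that by (auto intro: w_cont w_growth)
    show "M s \<noteq> {}" "bounded ((\<lambda>\<mu>. LINT x|\<mu>. wd s x) ` M s)" "\<And>\<mu>. \<mu> \<in> M s \<Longrightarrow> integrable \<mu> (wd s)"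
      "((\<lambda>h. (F (s + h) - F s) / h) \<longlongrightarrow> (SUP \<mu>\<in>M s. LINT x|\<mu>. wd s x)) (at_right 0)"
      "((\<lambda>h. (F (s + h) - F s) / h) \<longlongrightarrow> (INF \<mu>\<in>M s. LINT x|\<mu>. wd s x)) (at_left 0)"
      unfolding M_def F_def by (rule upper_exp_derivative[OF s wc deriv cont growth]; assumption)+
  qed

  \<comment> \<open>Control of the increments of \<open>F\<close> up to the endpoints\<close>
  define \<gamma> where "\<gamma> s = L * \<sigma>up * sqrt s - L * m * sqrt (1 - s)" for s
  define \<gamma>' where "\<gamma>' s = L * \<sigma>up / (2 * sqrt s) + L * m / (2 * sqrt (1 - s))" for s
  \<comment> \<open>Integrating \<open>interp_diff_le\<close> against \<open>\<mu>\<close> and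
    bounding the first moment by \<open>m\<close> gives exactly an increment of
    \<open>\<gamma>\<close>. The minus sign in \<open>\<gamma>\<close> compensates for
    \<open>sqrt (1 - s)\<close> being decreasing.\<close>
  have control: "\<bar>F s' - F s\<bar> \<le> \<gamma> s' - \<gamma> s" if s: "0 \<le> s" "s \<le> s'" "s' \<le> 1" for s s'
    unfolding F_def upper_exp_def
  proof (rule abs_SUP_diff_le[OF nonempty])
    have "\<bar>LINT x|\<mu>. ?w r x\<bar> \<le> B" if "\<mu> \<in> \<Theta>" "0 \<le> r" for \<mu> r
    proof -
      interpret prob_space \<mu> by (rule prob_space[OF that(1)])
      have "\<bar>LINT x|\<mu>. ?w r x\<bar> \<le> (LINT x|\<mu>. \<bar>?w r x\<bar>)" by (rule integral_abs_bound)
      also have "\<dots> \<le> (LINT x|\<mu>. B)"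
        by (intro integral_mono Bochner_Integration.integrable_abs w_int that w_bdd integrable_const)
      finally show ?thesis by (simp add: prob_space)
    qed
    then show "bdd_above ((\<lambda>\<mu>. LINT x|\<mu>. ?w s' x) ` \<Theta>)" "bdd_above ((\<lambda>\<mu>. LINT x|\<mu>. ?w s x) ` \<Theta>)"
      using s by (auto intro!: bdd_aboveI2[where M = B] simp: abs_le_iff)
    fix \<mu> assume \<mu>: "\<mu> \<in> \<Theta>"
    interpret prob_space \<mu> by (rule prob_space[OF \<mu>])
    define a where "a = L * \<sigma>up * (sqrt s' - sqrt s)"
    define b where "b = L * (sqrt (1 - s) - sqrt (1 - s'))"
    have b: "0 \<le> b" using L0 s by (simp add: b_def)
    have pt: "\<bar>?w s' x - ?w s x\<bar> \<le> a + b * \<bar>x\<bar>" for x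
      using interp_diff_le[OF \<sigma> v L, of s s' x] s by (simp add: a_def b_def mult_ac)
    have ib: "integrable \<mu> (\<lambda>x. b * \<bar>x\<bar>)" by (intro integrable_mult_right integrable_abs \<mu>)
    have "(LINT x|\<mu>. ?w s' x) - (LINT x|\<mu>. ?w s x) = (LINT x|\<mu>. ?w s' x - ?w s x)"
      using s by (intro Bochner_Integration.integral_diff[symmetric] w_int \<mu>) auto
    also have "\<bar>\<dots>\<bar> \<le> (LINT x|\<mu>. \<bar>?w s' x - ?w s x\<bar>)" by (rule integral_abs_bound)
    also have "\<dots> \<le> (LINT x|\<mu>. a + b * \<bar>x\<bar>)"
      using s by (intro integral_mono Bochner_Integration.integrable_abs Bochner_Integration.integrable_diff
          Bochner_Integration.integrable_add w_int \<mu> integrable_const ib pt) auto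
    also have "\<dots> = (LINT x|\<mu>. a) + (LINT x|\<mu>. b * \<bar>x\<bar>)"
      by (intro Bochner_Integration.integral_add integrable_const ib)
    also have "\<dots> = a + b * (LINT x|\<mu>. \<bar>x\<bar>)" by (simp add: prob_space)
    also have "\<dots> \<le> a + b * m" using m(2)[OF \<mu>] b by (intro add_left_mono mult_left_mono)
    also have "\<dots> = \<gamma> s' - \<gamma> s" by (simp add: a_def b_def \<gamma>_def algebra_simps)
    finally show "\<bar>(LINT x|\<mu>. ?w s' x) - (LINT x|\<mu>. ?w s x)\<bar> \<le> \<gamma> s' - \<gamma> s" .
  qed
  have \<gamma>: "continuous_on {0..1} \<gamma>" unfolding \<gamma>_def by (intro continuous_intros)
  have \<gamma>': "(\<gamma> has_real_derivative \<gamma>' s) (at s)" if "s \<in> {0<..<1}" for s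
    unfolding \<gamma>_def \<gamma>'_def using that
    by (auto intro!: derivative_eq_intros simp: field_simps)
  have \<gamma>'_cont: "continuous_on {0<..<1} \<gamma>'"
    unfolding \<gamma>'_def by (intro continuous_intros) auto

  \<comment> \<open>From the parameter derivative to \<open>L_G\<close>\<close>
  define Sf where "Sf s = 1 / (1 - s) * (SUP \<mu>\<in>M s. LINT x|\<mu>. L_G \<sigma>low \<sigma>up (?w s) x)" for s
  define If where "If s = 1 / (1 - s) * (INF \<mu>\<in>M s. LINT x|\<mu>. L_G \<sigma>low \<sigma>up (?w s) x)" for s
  have LG: "L_G \<sigma>low \<sigma>up (?w s) x = (1 - s) * wd s x" if "s \<in> {0<..<1}" for s x
    using that by (simp add: wd_def)
  have LG_int: "(LINT x|\<mu>. L_G \<sigma>low \<sigma>up (?w s) x) = (1 - s) * (LINT x|\<mu>. wd s x)" if "s \<in> {0<..<1}" for s \<mu>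
    by (simp add: LG[OF that])
  \<comment> \<open>The factor \<open>1 - s\<close> passes through the real supremum and infimum
    because the values form a nonempty bounded set, and then cancels against
    \<open>1 / (1 - s)\<close>.\<close>
  have Sf: "Sf s = (SUP \<mu>\<in>M s. LINT x|\<mu>. wd s x)" and If: "If s = (INF \<mu>\<in>M s. LINT x|\<mu>. wd s x)"
    if s: "s \<in> {0<..<1}" for s
    using real_SUP_cmult[OF _ D(2,1)[OF s], of "1 - s"] real_INF_cmult[OF _ D(2,1)[OF s], of "1 - s"] s
    by (simp_all add: Sf_def If_def LG_int)
  have first: "M s \<noteq> {} \<and> (\<forall>\<mu>\<in>M s. integrable \<mu> (L_G \<sigma>low \<sigma>up (?w s))) \<and>
      bounded ((\<lambda>\<mu>. LINT x|\<mu>. L_G \<sigma>low \<sigma>up (?w s) x) ` M s)" if s: "s \<in> {0<..<1}" for s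
  proof (intro conjI ballI D(1)[OF s])
    show "integrable \<mu> (L_G \<sigma>low \<sigma>up (?w s))" if "\<mu> \<in> M s" for \<mu>
      using integrable_mult_right[OF D(3)[OF s that], of "1 - s"] by (simp flip: LG[OF s])
    show "bounded ((\<lambda>\<mu>. LINT x|\<mu>. L_G \<sigma>low \<sigma>up (?w s) x) ` M s)"
      using bounded_scaling[OF D(2)[OF s], of "1 - s"] by (simp add: LG_int[OF s] image_image)
  qed

  \<comment> \<open>Integration of the two one-sided derivatives\<close>
  define h where "h n = inverse (real (Suc n))" for n
  have h: "h \<longlonglongrightarrow> 0" "\<And>n. 0 < h n" using LIMSEQ_inverse_real_of_nat by (auto simp: h_def[abs_def])
  have hr: "filterlim h (at_right 0) sequentially"
    by (simp add: filterlim_at h less_imp_neq[OF h(2), symmetric])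
  have hl: "filterlim (\<lambda>n. - h n) (at_left 0) sequentially"
    using tendsto_minus[OF h(1)] by (simp add: filterlim_at h(2) less_imp_neq[OF h(2), symmetric])
  have S: "set_integrable lborel {0<..<1} Sf" "(LINT s:{0<..<1}|lborel. Sf s) = F 1 - F 0"
  proof -
    have "(\<lambda>n. (F (s + h n) - F s) / h n) \<longlonglongrightarrow> Sf s" if "s \<in> {0<..<1}" for s
      using filterlim_compose[OF D(4)[OF that] hr] by (simp add: Sf[OF that])
    moreover have "h n \<noteq> 0" for n using h(2)[of n] by simp
    ultimately show "set_integrable lborel {0<..<1} Sf" "(LINT s:{0<..<1}|lborel. Sf s) = F 1 - F 0"
      using difference_quotient_FTC[OF zero_less_one control \<gamma> \<gamma>' \<gamma>'_cont h(1)] by blast+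
  qed
  have I: "set_integrable lborel {0<..<1} If" "(LINT s:{0<..<1}|lborel. If s) = F 1 - F 0"
  proof -
    \<comment> \<open>Negative increments sample the left derivative, so the same integration lemma
      yields the infimum.\<close>
    have "(\<lambda>n. (F (s + - h n) - F s) / - h n) \<longlonglongrightarrow> If s" if "s \<in> {0<..<1}" for s
      using filterlim_compose[OF D(5)[OF that] hl] by (simp add: If[OF that])
    moreover have "- h n \<noteq> 0" for n using h(2)[of n] by simp
    moreover have "(\<lambda>n. - h n) \<longlonglongrightarrow> 0" using tendsto_minus[OF h(1)] by simp
    ultimately show "set_integrable lborel {0<..<1} If" "(LINT s:{0<..<1}|lborel. If s) = F 1 - F 0"
      using difference_quotient_FTC[OF zero_less_one control \<gamma> \<gamma>' \<gamma>'_cont, of "\<lambda>n. - h n"] by blast+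
  qed
  have F1: "F 1 = G_normal \<sigma>low \<sigma>up \<phi>"
  proof -
    \<comment> \<open>At parameter 1 the factor \<open>sqrt (1 - s)\<close> vanishes, so the
      interpolation is constant and every probability measure gives the same integral.\<close>
    have "(LINT x|\<mu>. ?w 1 x) = v 0 1" if "\<mu> \<in> \<Theta>" for \<mu>
    proof -
      interpret prob_space \<mu> by (rule prob_space[OF that])
      show ?thesis by (simp add: interp_def prob_space)
    qed
    then show ?thesis using nonempty by (simp add: F_def upper_exp_def G_normal_eq[OF \<sigma>(1,2) v])
  qed
  have "?w 0 = \<phi>" using v by (auto simp: interp_def G_heat_solution_def)
  then have F0: "F 0 = upper_exp \<Theta> \<phi>" by (simp add: F_def)
  have le: "If s \<le> Sf s" if s: "s \<in> {0<..<1}" for s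
  proof -
    obtain \<mu> where \<mu>: "\<mu> \<in> M s" using D(1)[OF s] by blast
    then show ?thesis
      unfolding Sf[OF s] If[OF s] using D(2)[OF s]
      by (intro order_trans[OF cINF_lower[OF _ \<mu>] cSUP_upper[OF \<mu>]]
          bounded_imp_bdd_above bounded_imp_bdd_below)
  qed
  have "AE s in lborel. s \<in> {0<..<1} \<longrightarrow> Sf s - If s = 0"
  proof -
    have int: "set_integrable lborel {0<..<1} (\<lambda>s. Sf s - If s)" by (rule set_integral_diff(1)[OF S(1) I(1)])
    have "(LINT s:{0<..<1}|lborel. Sf s - If s) = 0"
      using set_integral_diff(2)[OF S(1) I(1)] S(2) I(2) by simp
    then have "AE s in lborel. indicator {0<..<1} s *\<^sub>R (Sf s - If s) = 0"
      using le int unfolding set_lebesgue_integral_def set_integrable_def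
      by (subst (asm) integral_nonneg_eq_0_iff_AE) (auto simp: indicator_def)
    then show ?thesis by eventually_elim (auto simp: indicator_def)
  qed
  then have ae: "AE s in lborel. s \<in> {0<..<1} \<longrightarrow>
       (SUP \<mu>\<in>M s. LINT x|\<mu>. L_G \<sigma>low \<sigma>up (?w s) x) = (INF \<mu>\<in>M s. LINT x|\<mu>. L_G \<sigma>low \<sigma>up (?w s) x)"
    by eventually_elim (auto simp: Sf_def If_def)
  show ?thesis
    using first S I ae F0 F1 unfolding Sf_def If_def M_def by simp
qed

end
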